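(* Let $\pmb\lambda$ be a $d$-tuple of partitions of $m$, with $n\ge\ell(\lambda^{(i)})$ and $n\ge\lambda^{(i)}_1$ for all $i$. (i) For odd $d$: $$\Delta_T=(-1)^{\pmb\lambda}\sum_{S\in A^{\mathrm{lex}}(\pmb\lambda)}\langle\nabla_S,\textstyle\bigwedge e_T\rangle\bigvee e_S\quad (T\in B(\pmb\lambda')),\qquad \nabla_S=(-1)^{\pmb\lambda}\sum_{T\in B^{\mathrm{lex}}(\pmb\lambda')}\langle\Delta_T,\bigvee e_S\rangle\bigwedge e_T\quad(S\in A(\pmb\lambda)).$$ (ii) For even $d$: $$\Delta_S=(-1)^{\pmb\lambda}\sum_{S'\in A^{\mathrm{lex}}(\pmb\lambda')}\langle\Delta_{S'},\textstyle\bigvee e_S\rangle\bigvee e_{S'}\quad(S\in A(\pmb\lambda)),\qquad\nabla_T=(-1)^{\pmb\lambda}\sum_{T'\in B^{\mathrm{lex}}(\pmb\lambda')}\langle\nabla_{T'},\bigwedge e_T\rangle\bigwedge e_{T'}\quad(T\in B(\pmb\lambda)).$$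
   Context: Integers $d,n\ge1$, $m\ge0$; $[r]=\{1,\dots,r\}$. $V=(\mathbb C^n)^{\otimes d}$ with basis $e_{\mathbf i}=e_{i_1}\otimes\cdots\otimes e_{i_d}$, $\mathbf i\in[n]^d$. $\bigvee V$ is the symmetric algebra (polynomial ring in commuting variables $e_{\mathbf i}$), $\bigwedge V$ the exterior algebra. $\pmb\lambda'$ is the componentwise conjugate of $\pmb\lambda$. Words/tables: for a sequence $\alpha$ of nonnegative integers with sum $m$, $A(\alpha)$ is the set of words of length $m$ in which letter $i$ occurs $\alpha_i$ times; $A(\pmb\alpha)=A(\alpha^{(1)})\times\cdots\times A(\alpha^{(d)})$ viewed as $d\times m$ tables with columns $S(1),\dots,S(m)$; $B(\pmb\alpha)$: tables with pairwise distinct columns; $A^{\mathrm{lex}},B^{\mathrm{lex}}$: those whose columns are weakly increasing lexicographically. $S_m$ acts by permuting columns. $\|T\|=\prod_{\mathbf c}(\#\{j:T(j)=\mathbf c\})!$. $\bigvee e_S=e_{S(1)}\cdots e_{S(m)}$, $\bigwedge e_S=e_{S(1)}\wedge\cdots\wedge e_{S(m)}$. The pairing $\langle\cdot,\cdot\rangle$ is the bilinear form for which the monomials $\bigvee e_S$ ($S$ lex) are orthonormal, resp. the $\bigwedge e_S$ ($S\in B^{\mathrm{lex}}$) are orthonormal; so $\langle v,\bigvee e_S\rangle$ is the coefficient of the monomial $\bigvee e_S$ in $v$, and for a non-lex $T$ with $\bigwedge e_T=\epsilon\bigwedge e_{T_0}$ ($T_0$ its lex sorting) one has $\langle v,\bigwedge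 e_T\rangle=\epsilon\langle v,\bigwedge e_{T_0}\rangle$. Signs: $(-1)^w=(-1)^{\#\{i<j:w_i>w_j\}}$; $(-1)^T=\prod_i(-1)^{t_i}$ over rows. For a partition $\lambda=(\lambda_1,\dots,\lambda_\ell)$, $(-1)^\lambda=(-1)^w$ with $w=12\cdots\lambda_1\,12\cdots\lambda_2\cdots12\cdots\lambda_\ell$, and $(-1)^{\pmb\lambda}=\prod_i(-1)^{\lambda^{(i)}}$. For words $s,x$ of length $m$, $\mathrm{sgn}_s(x)=\prod_c\mathrm{sgn}(x_{b_1},\dots,x_{b_k})$ over letters $c$ of $s$ with positions $b_1<\dots<b_k$, where $\mathrm{sgn}(a_1,\dots,a_k)$ is the permutation sign if $(a_1,\dots,a_k)$ is a permutation of $[k]$ and $0$ otherwise; $\mathrm{sgn}_T(X)=\prod_i\mathrm{sgn}_{t_i}(x_i)$. Vectors: for a $d\times m$ table $T$ of positive integers, $\Delta_T=\frac{(-1)^T}{\|T\|}\sum_X\mathrm{sgn}_T(X)\bigvee e_X$ and $\nabla_T=\frac{(-1)^T}{\|T\|}\sum_X\mathrm{sgn}_T(X)\bigwedge e_X$, sums over all $d\times m$ tables $X$ with entries in $[n]$. *)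

theory Defs
  imports
    Complex_Main
    "HOL-Library.Poly_Mapping"
    "HOL-Library.List_Lexorder"
    "HOL-Library.FSet"
    "HOL-Combinatorics.Permutations"
begin

section \<open>The symmetric and the exterior algebra on a basis\<close>

text \<open>
  Both algebras are represented by finitely supported coefficient functions on their standard
  bases: monomials (finitely supported exponent functions) for the symmetric algebra, finite
  sets of basis indices for the exterior algebra.  On \<^typ>\<open>('v \<Rightarrow>\<^sub>0 nat) \<Rightarrow>\<^sub>0 complex\<close> the product of
  the type class is the multiplication of the polynomial ring in commuting variables.

  The basis of \<open>V\<close> is indexed by \<^typ>\<open>nat list\<close>; only the indices of length \<open>d\<close> with
  entries in \<open>{1..n}\<close> occur below.  The order on \<^typ>\<open>nat list\<close> is the lexicographic one.
\<close>

type_synonym 'v sym = "('v \<Rightarrow>\<^sub>0 nat) \<Rightarrow>\<^sub>0 complex"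
type_synonym 'v ext = "'v fset \<Rightarrow>\<^sub>0 complex"

definition smul :: "complex \<Rightarrow> ('k \<Rightarrow>\<^sub>0 complex) \<Rightarrow> ('k \<Rightarrow>\<^sub>0 complex)" where
  "smul c v = Poly_Mapping.map (\<lambda>x. c * x) v"

lemma lookup_smul [simp]: "Poly_Mapping.lookup (smul c v) k = c * Poly_Mapping.lookup v k"
  by (simp add: smul_def Poly_Mapping.map.rep_eq when_def)

definition pairing :: "('k \<Rightarrow>\<^sub>0 complex) \<Rightarrow> ('k \<Rightarrow>\<^sub>0 complex) \<Rightarrow> complex" where
  "pairing v w = (\<Sum>k\<in>Poly_Mapping.keys v. Poly_Mapping.lookup v k * Poly_Mapping.lookup w k)"

lemma pairing_single: "pairing v (Poly_Mapping.single k 1) = Poly_Mapping.lookup v k"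
proof -
  have "pairing v (Poly_Mapping.single k 1) = (\<Sum>k'\<in>Poly_Mapping.keys v. if k' = k then Poly_Mapping.lookup v k else 0)"
    unfolding pairing_def by (rule sum.cong) (auto simp: lookup_single when_def)
  thus ?thesis by (simp add: sum.delta Poly_Mapping.in_keys_iff)
qed

lemma poly_mapping_single_induct [case_names single add]:
  fixes v :: "'k \<Rightarrow>\<^sub>0 'b::comm_monoid_add"
  assumes single: "\<And>k x. P (Poly_Mapping.single k x)"
    and add: "\<And>u v. P u \<Longrightarrow> P v \<Longrightarrow> P (u + v)"
  shows "P v"
proof -
  have P0: "P 0" using single[of undefined 0] by simp
  have "P (\<Sum>k\<in>K. Poly_Mapping.single k (Poly_Mapping.lookup v k))" if "finite K" for K
    using that by (induction K) (auto simp: P0 single add)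
  moreover have "(\<Sum>k\<in>Poly_Mapping.keys v. Poly_Mapping.single k (Poly_Mapping.lookup v k)) = v"
    by (rule poly_mapping_eqI)
       (simp add: lookup_sum lookup_single when_def sum.delta Poly_Mapping.in_keys_iff)
  ultimately show ?thesis by (metis finite_keys)
qed

definition sym_gen :: "'v \<Rightarrow> 'v sym" where
  "sym_gen i = Poly_Mapping.single (Poly_Mapping.single i 1) 1"

definition ext_gen :: "'v \<Rightarrow> 'v ext" where
  "ext_gen i = Poly_Mapping.single {|i|} 1"

definition ext_one :: "'v ext" where
  "ext_one = Poly_Mapping.single {||} 1"

text \<open>
  The basis element of a finite set \<open>A\<close> stands for the wedge product of the generators indexed
  by \<open>A\<close> in increasing order.  Hence the product of the basis elements of \<open>A\<close> and \<open>B\<close> is, for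
  disjoint \<open>A\<close>, \<open>B\<close>, that of the union up to the sign of the shuffle that sorts \<open>A\<close> followed by
  \<open>B\<close>, and zero otherwise.
\<close>

definition shuffle_sign :: "'v::linorder fset \<Rightarrow> 'v fset \<Rightarrow> complex" where
  "shuffle_sign A B =
     (if A |\<inter>| B = {||} then (- 1) ^ card {(a, b). a |\<in>| A \<and> b |\<in>| B \<and> b < a} else 0)"

definition wedge :: "'v::linorder ext \<Rightarrow> 'v ext \<Rightarrow> 'v ext" where
  "wedge v w = (\<Sum>A\<in>Poly_Mapping.keys v. \<Sum>B\<in>Poly_Mapping.keys w.
     Poly_Mapping.single (A |\<union>| B) (shuffle_sign A B * Poly_Mapping.lookup v A * Poly_Mapping.lookup w B))"

text \<open>
  The next facts confirm that this is the exterior algebra: \<open>wedge\<close> is bilinear, associative and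
  unital, vectors square to zero, and the increasing products of generators are the basis.
\<close>

lemma wedge_superset:
  assumes "finite K" "finite L" "Poly_Mapping.keys v \<subseteq> K" "Poly_Mapping.keys w \<subseteq> L"
  shows "wedge v w = (\<Sum>A\<in>K. \<Sum>B\<in>L.
     Poly_Mapping.single (A |\<union>| B) (shuffle_sign A B * Poly_Mapping.lookup v A * Poly_Mapping.lookup w B))"
proof -
  have "wedge v w = (\<Sum>A\<in>Poly_Mapping.keys v. \<Sum>B\<in>L.
     Poly_Mapping.single (A |\<union>| B) (shuffle_sign A B * Poly_Mapping.lookup v A * Poly_Mapping.lookup w B))"
    unfolding wedge_def
    by (intro sum.cong refl sum.mono_neutral_left) (use assms in \<open>auto simp: Poly_Mapping.in_keys_iff\<close>)
  also have "\<dots> = (\<Sum>A\<in>K. \<Sum>B\<in>L.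
     Poly_Mapping.single (A |\<union>| B) (shuffle_sign A B * Poly_Mapping.lookup v A * Poly_Mapping.lookup w B))"
    by (intro sum.mono_neutral_left) (use assms in \<open>auto simp: Poly_Mapping.in_keys_iff\<close>)
  finally show ?thesis .
qed

lemma wedge_add_left: "wedge (u + v) w = wedge u w + wedge v w"
proof -
  let ?K = "Poly_Mapping.keys u \<union> Poly_Mapping.keys v"
  have "Poly_Mapping.keys (u + v) \<subseteq> ?K" by (rule Poly_Mapping.keys_add)
  thus ?thesis
    by (subst (1 2 3) wedge_superset[where K = ?K and L = "Poly_Mapping.keys w"])
       (auto simp: lookup_add algebra_simps single_add sum.distrib)
qed

lemma wedge_add_right: "wedge w (u + v) = wedge w u + wedge w v"
proof -
  let ?K = "Poly_Mapping.keys u \<union> Poly_Mapping.keys v"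
  have "Poly_Mapping.keys (u + v) \<subseteq> ?K" by (rule Poly_Mapping.keys_add)
  thus ?thesis
    by (subst (1 2 3) wedge_superset[where L = ?K and K = "Poly_Mapping.keys w"])
       (auto simp: lookup_add algebra_simps single_add sum.distrib)
qed

lemma wedge_single:
  "wedge (Poly_Mapping.single A a) (Poly_Mapping.single B b) =
     Poly_Mapping.single (A |\<union>| B) (shuffle_sign A B * a * b)"
  by (subst wedge_superset[where K = "{A}" and L = "{B}"]) auto

lemma wedge_zero_left [simp]: "wedge 0 v = 0"
  and wedge_zero_right [simp]: "wedge v 0 = 0"
  by (simp_all add: wedge_def)

lemma smul_add: "smul c (u + v) = smul c u + smul c v"
  by (rule poly_mapping_eqI) (simp add: lookup_add algebra_simps)

lemma smul_single: "smul c (Poly_Mapping.single k x) = Poly_Mapping.single k (c * x)"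
  by (rule poly_mapping_eqI) (simp add: lookup_single when_def)

lemma wedge_single_smul:
  "wedge (smul c (Poly_Mapping.single A a)) v = smul c (wedge (Poly_Mapping.single A a) v)"
  "wedge (Poly_Mapping.single A a) (smul c v) = smul c (wedge (Poly_Mapping.single A a) v)"
  by (induction v rule: poly_mapping_single_induct)
     (simp_all add: smul_add smul_single wedge_add_right wedge_single mult_ac)

lemma wedge_smul_left: "wedge (smul c v) w = smul c (wedge v w)"
  by (induction v rule: poly_mapping_single_induct)
     (simp_all add: smul_add wedge_add_left wedge_single_smul)

lemma wedge_smul_right: "wedge v (smul c w) = smul c (wedge v w)"
  by (induction v rule: poly_mapping_single_induct)
     (simp_all add: smul_add wedge_add_left wedge_single_smul)

lemma shuffle_sign_union_left:
  assumes "A |\<inter>| B = {||}"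
  shows "shuffle_sign (A |\<union>| B) C = shuffle_sign A C * shuffle_sign B C"
proof (cases "A |\<inter>| C = {||} \<and> B |\<inter>| C = {||}")
  case True
  have "{(a, b). a |\<in>| A |\<union>| B \<and> b |\<in>| C \<and> b < a} =
      {(a, b). a |\<in>| A \<and> b |\<in>| C \<and> b < a} \<union> {(a, b). a |\<in>| B \<and> b |\<in>| C \<and> b < a}"
    by auto
  moreover have "finite {(a, b). a |\<in>| X \<and> b |\<in>| C \<and> b < a}" for X
    by (rule finite_subset[of _ "fset X \<times> fset C"]) auto
  moreover have "{(a, b). a |\<in>| A \<and> b |\<in>| C \<and> b < a} \<inter> {(a, b). a |\<in>| B \<and> b |\<in>| C \<and> b < a} = {}"
    using assms by auto
  ultimately have "card {(a, b). a |\<in>| A |\<union>| B \<and> b |\<in>| C \<and> b < a} =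
      card {(a, b). a |\<in>| A \<and> b |\<in>| C \<and> b < a} + card {(a, b). a |\<in>| B \<and> b |\<in>| C \<and> b < a}"
    by (simp add: card_Un_disjoint)
  thus ?thesis using True
    by (simp add: shuffle_sign_def power_add inf_sup_distrib2 del: funion_iff)
next
  case False
  thus ?thesis by (auto simp: shuffle_sign_def inf_sup_distrib2)
qed

lemma shuffle_sign_union_right:
  assumes "A |\<inter>| B = {||}"
  shows "shuffle_sign C (A |\<union>| B) = shuffle_sign C A * shuffle_sign C B"
proof (cases "C |\<inter>| A = {||} \<and> C |\<inter>| B = {||}")
  case True
  have "{(a, b). a |\<in>| C \<and> b |\<in>| A |\<union>| B \<and> b < a} =
      {(a, b). a |\<in>| C \<and> b |\<in>| A \<and> b < a} \<union> {(a, b). a |\<in>| C \<and> b |\<in>| B \<and> b < a}"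
    by auto
  moreover have "finite {(a, b). a |\<in>| C \<and> b |\<in>| X \<and> b < a}" for X
    by (rule finite_subset[of _ "fset C \<times> fset X"]) auto
  moreover have "{(a, b). a |\<in>| C \<and> b |\<in>| A \<and> b < a} \<inter> {(a, b). a |\<in>| C \<and> b |\<in>| B \<and> b < a} = {}"
    using assms by auto
  ultimately have "card {(a, b). a |\<in>| C \<and> b |\<in>| A |\<union>| B \<and> b < a} =
      card {(a, b). a |\<in>| C \<and> b |\<in>| A \<and> b < a} + card {(a, b). a |\<in>| C \<and> b |\<in>| B \<and> b < a}"
    by (simp add: card_Un_disjoint)
  thus ?thesis using True
    by (simp add: shuffle_sign_def power_add inf_sup_distrib1 del: funion_iff)
next
  case False
  thus ?thesis by (auto simp: shuffle_sign_def inf_sup_distrib1)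
qed

lemma shuffle_sign_assoc:
  "shuffle_sign A B * shuffle_sign (A |\<union>| B) C = shuffle_sign A (B |\<union>| C) * shuffle_sign B C"
proof (cases "A |\<inter>| B = {||}")
  case AB: True
  show ?thesis
  proof (cases "B |\<inter>| C = {||}")
    case True
    thus ?thesis using AB by (simp add: shuffle_sign_union_left shuffle_sign_union_right)
  next
    case False
    thus ?thesis using AB by (simp add: shuffle_sign_union_left) (simp add: shuffle_sign_def)
  qed
next
  case False
  hence "A |\<inter>| (B |\<union>| C) \<noteq> {||}" by auto
  thus ?thesis using False by (simp add: shuffle_sign_def)
qed

lemma wedge_assoc: "wedge (wedge u v) w = wedge u (wedge v w)"
proof (induction u rule: poly_mapping_single_induct)
  case u: (single A a)
  show ?case
  proof (induction v rule: poly_mapping_single_induct)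
    case v: (single B b)
    show ?case
    proof (induction w rule: poly_mapping_single_induct)
      case (single C c)
      have "shuffle_sign (A |\<union>| B) C * (shuffle_sign A B * a * b) * c =
          (shuffle_sign A B * shuffle_sign (A |\<union>| B) C) * (a * b * c)"
        by (simp add: mult_ac)
      thus ?case by (simp add: wedge_single shuffle_sign_assoc sup_assoc mult_ac)
    qed (simp add: wedge_add_right)
  qed (simp add: wedge_add_left wedge_add_right)
qed (simp add: wedge_add_left)

lemma wedge_one_left: "wedge ext_one v = v"
  by (induction v rule: poly_mapping_single_induct)
     (simp_all add: wedge_add_right ext_one_def wedge_single shuffle_sign_def)

lemma wedge_one_right: "wedge v ext_one = v"
  by (induction v rule: poly_mapping_single_induct)
     (simp_all add: wedge_add_left ext_one_def wedge_single shuffle_sign_def)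

lemma shuffle_sign_singletons: "shuffle_sign {|i|} {|j|} = - shuffle_sign {|j|} {|i|}"
proof -
  have "{(a, b). a |\<in>| {|i|} \<and> b |\<in>| {|j|} \<and> b < a} = (if j < i then {(i, j)} else {})" for i j :: 'a
    by auto
  thus ?thesis by (cases i j rule: linorder_cases) (auto simp: shuffle_sign_def)
qed

lemma wedge_square:
  assumes "Poly_Mapping.keys v \<subseteq> range (\<lambda>i. {|i|})"
  shows "wedge v v = 0"
proof -
  let ?t = "\<lambda>A B. Poly_Mapping.single (A |\<union>| B) (shuffle_sign A B * Poly_Mapping.lookup v A * Poly_Mapping.lookup v B)"
  have "wedge v v = (\<Sum>B\<in>Poly_Mapping.keys v. \<Sum>A\<in>Poly_Mapping.keys v. ?t A B)"
    unfolding wedge_def by (rule sum.swap)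
  also have "\<dots> = (\<Sum>B\<in>Poly_Mapping.keys v. \<Sum>A\<in>Poly_Mapping.keys v. - ?t B A)"
  proof (intro sum.cong refl)
    fix A B assume "B \<in> Poly_Mapping.keys v" "A \<in> Poly_Mapping.keys v"
    then obtain i j where "A = {|i|}" "B = {|j|}" using assms by blast
    hence "shuffle_sign A B = - shuffle_sign B A" by (simp add: shuffle_sign_singletons[of i j])
    thus "?t A B = - ?t B A" by (simp add: single_uminus[symmetric] sup_commute mult_ac)
  qed
  also have "\<dots> = - wedge v v" by (simp add: wedge_def sum_negf)
  finally have eq: "wedge v v = - wedge v v" .
  show ?thesis
  proof (rule poly_mapping_eqI)
    fix k
    have "Poly_Mapping.lookup (wedge v v) k = - Poly_Mapping.lookup (wedge v v) k"
      using arg_cong[OF eq, of "\<lambda>x. Poly_Mapping.lookup x k"] by simp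
    thus "Poly_Mapping.lookup (wedge v v) k = Poly_Mapping.lookup 0 k" by simp
  qed
qed

definition sym_word :: "'v list \<Rightarrow> 'v sym" where
  "sym_word cs = prod_list (map sym_gen cs)"

definition ext_word :: "'v::linorder list \<Rightarrow> 'v ext" where
  "ext_word cs = foldr wedge (map ext_gen cs) ext_one"

lemma sym_word_eq_single:
  "sym_word cs = Poly_Mapping.single (\<Sum>c\<leftarrow>cs. Poly_Mapping.single c 1) 1"
  by (induction cs) (simp_all add: sym_word_def sym_gen_def mult_single single_one)

lemma ext_word_increasing:
  assumes "sorted_wrt (<) cs"
  shows "ext_word cs = Poly_Mapping.single (fset_of_list cs) 1"
  using assms
proof (induction cs)
  case Nil
  thus ?case by (simp add: ext_word_def ext_one_def)
next
  case (Cons c cs)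
  have "{(a, b). a |\<in>| {|c|} \<and> b |\<in>| fset_of_list cs \<and> b < a} = {}"
    using Cons.prems by (auto simp: fset_of_list_elem)
  moreover have "{|c|} |\<inter>| fset_of_list cs = {||}"
    using Cons.prems by (auto simp: fset_of_list_elem)
  ultimately have "shuffle_sign {|c|} (fset_of_list cs) = 1"
    by (simp only: shuffle_sign_def simp_thms if_True card.empty power_0)
  moreover have "ext_word (c # cs) = wedge (ext_gen c) (ext_word cs)"
    by (simp add: ext_word_def)
  ultimately show ?case using Cons by (simp add: ext_gen_def wedge_single)
qed

section \<open>Partitions, words and tables\<close>

text \<open>
  A sequence \<open>\<alpha>\<close> of nonnegative integers is a list, read as \<open>(\<alpha>\<^sub>1, \<alpha>\<^sub>2, \<dots>)\<close> and
  continued by zeros; \<open>part \<alpha> i\<close> is \<open>\<alpha>\<^sub>i\<close>.  A partition has positive parts, so that its number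
  of parts is the length of the list.
\<close>

definition part :: "nat list \<Rightarrow> nat \<Rightarrow> nat" where
  "part \<alpha> i = (if 1 \<le> i \<and> i \<le> length \<alpha> then \<alpha> ! (i - 1) else 0)"

definition partition_of :: "nat \<Rightarrow> nat list \<Rightarrow> bool" where
  "partition_of m \<mu> \<longleftrightarrow> sorted_wrt (\<ge>) \<mu> \<and> 0 \<notin> set \<mu> \<and> sum_list \<mu> = m"

definition conjugate :: "nat list \<Rightarrow> nat list" where
  "conjugate \<mu> = map (\<lambda>j. card {i. 1 \<le> i \<and> i \<le> length \<mu> \<and> j \<le> part \<mu> i}) [1..<Suc (part \<mu> 1)]"

definition words :: "nat list \<Rightarrow> nat list set" where
  "words \<alpha> = {w. length w = sum_list \<alpha> \<and> (\<forall>i. count_list w i = part \<alpha> i)}"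

text \<open>
  A table is the list of its rows.  For a rectangular table with at least one row,
  \<^const>\<open>List.transpose\<close> is the list \<open>S(1), \<dots>, S(m)\<close> of its columns, also if \<open>m = 0\<close>.
\<close>

type_synonym table = "nat list list"

definition tables :: "nat \<Rightarrow> nat \<Rightarrow> nat \<Rightarrow> table set" where
  "tables d m n = {X. length X = d \<and> (\<forall>x\<in>set X. length x = m \<and> set x \<subseteq> {1..n})}"

definition A_tab :: "nat list list \<Rightarrow> table set" where
  "A_tab \<alpha>s = {S. length S = length \<alpha>s \<and> (\<forall>i<length \<alpha>s. S ! i \<in> words (\<alpha>s ! i))}"

definition B_tab :: "nat list list \<Rightarrow> table set" where
  "B_tab \<alpha>s = {S \<in> A_tab \<alpha>s. distinct (List.transpose S)}"

definition A_lex :: "nat list list \<Rightarrow> table set" where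
  "A_lex \<alpha>s = {S \<in> A_tab \<alpha>s. sorted (List.transpose S)}"

definition B_lex :: "nat list list \<Rightarrow> table set" where
  "B_lex \<alpha>s = {S \<in> B_tab \<alpha>s. sorted (List.transpose S)}"

lemma finite_A_tab: "finite (A_tab \<alpha>s)"
proof -
  have fw: "finite (words \<alpha>)" for \<alpha>
  proof (rule finite_subset)
    show "words \<alpha> \<subseteq> {w. set w \<subseteq> {..length \<alpha>} \<and> length w = sum_list \<alpha>}"
    proof
      fix w assume w: "w \<in> words \<alpha>"
      have "i \<le> length \<alpha>" if "i \<in> set w" for i
      proof (rule ccontr)
        assume "\<not> i \<le> length \<alpha>"
        hence "count_list w i = 0" using w by (simp add: words_def part_def)
        thus False using that by (simp add: count_list_0_iff)
      qed
      thus "w \<in> {w. set w \<subseteq> {..length \<alpha>} \<and> length w = sum_list \<alpha>}"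
        using w by (auto simp: words_def)
    qed
  qed (simp add: finite_lists_length_eq)
  have "A_tab \<alpha>s \<subseteq> {S. set S \<subseteq> (\<Union>\<alpha>\<in>set \<alpha>s. words \<alpha>) \<and> length S = length \<alpha>s}"
    by (fastforce simp: A_tab_def in_set_conv_nth)
  thus ?thesis
    by (rule finite_subset) (simp add: finite_lists_length_eq fw)
qed

definition mult_norm :: "table \<Rightarrow> nat" where
  "mult_norm T = (\<Prod>c\<in>set (List.transpose T). fact (count_list (List.transpose T) c))"

definition sym_tab :: "table \<Rightarrow> nat list sym" where
  "sym_tab S = sym_word (List.transpose S)"

definition ext_tab :: "table \<Rightarrow> nat list ext" where
  "ext_tab S = ext_word (List.transpose S)"

section \<open>Signs\<close>

definition word_sign :: "nat list \<Rightarrow> complex" where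
  "word_sign w = (- 1) ^ card {(i, j). i < j \<and> j < length w \<and> w ! i > w ! j}"

definition table_sign :: "table \<Rightarrow> complex" where
  "table_sign T = (\<Prod>t\<leftarrow>T. word_sign t)"

definition partition_sign :: "nat list \<Rightarrow> complex" where
  "partition_sign \<mu> = word_sign (concat (map (\<lambda>p. [1..<Suc p]) \<mu>))"

definition partitions_sign :: "nat list list \<Rightarrow> complex" where
  "partitions_sign \<mu>s = (\<Prod>\<mu>\<leftarrow>\<mu>s. partition_sign \<mu>)"

definition perm_sgn :: "nat list \<Rightarrow> complex" where
  "perm_sgn a =
     (if distinct a \<and> set a = {1..length a}
      then of_int (sign (\<lambda>i. if i \<in> {1..length a} then a ! (i - 1) else i))
      else 0)"

definition word_sgn :: "nat list \<Rightarrow> nat list \<Rightarrow> complex" where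
  "word_sgn s x = (\<Prod>c\<in>set s. perm_sgn (nths x {b. b < length s \<and> s ! b = c}))"

definition table_sgn :: "table \<Rightarrow> table \<Rightarrow> complex" where
  "table_sgn T X = (\<Prod>i<length T. word_sgn (T ! i) (X ! i))"

section \<open>The vectors\<close>

definition Delta :: "nat \<Rightarrow> nat \<Rightarrow> nat \<Rightarrow> table \<Rightarrow> nat list sym" where
  "Delta d m n T = smul (table_sign T / of_nat (mult_norm T))
     (\<Sum>X\<in>tables d m n. smul (table_sgn T X) (sym_tab X))"

definition Nabla :: "nat \<Rightarrow> nat \<Rightarrow> nat \<Rightarrow> table \<Rightarrow> nat list ext" where
  "Nabla d m n T = smul (table_sign T / of_nat (mult_norm T))
     (\<Sum>X\<in>tables d m n. smul (table_sgn T X) (ext_tab X))"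

end

theory Submission
  imports Defs "HOL-Library.Product_Lexorder" "HOL-Combinatorics.Multiset_Permutations"
begin

text \<open>
  For words \<open>t\<close> of content \<open>\<lambda>'\<close> and \<open>s\<close> of content \<open>\<lambda>\<close>, the number \<open>(-1)\<^sup>t sgn\<^sub>t(s)\<close> is nonzero iff
  the pairs \<open>(t\<^sub>j, s\<^sub>j)\<close> run exactly once through the cells of the Young diagram, and then it is the
  inversion sign of this list of pairs for the lexicographic order.  Reading the diagram by columns
  instead of rows multiplies it by a sign that depends on \<open>\<lambda>\<close> only, namely \<open>(-1)\<^sup>\<lambda>\<close>.  Hence
  \<open>F(T, S) = (-1)\<^sup>T sgn\<^sub>T(S)\<close> satisfies \<open>F(T, S) = (-1)\<^sup>\<lambda> F(S, T)\<close>, and permuting the columns of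
  both tables by \<open>\<sigma>\<close> multiplies it by \<open>sgn(\<sigma>)\<^sup>d\<close>.  The coefficients of \<open>\<Delta>\<^sub>T\<close> and \<open>\<nabla>\<^sub>T\<close> are, up to
  the norms of the tables, the sums of \<open>F(T, S\<sigma>)\<close> and of \<open>sgn(\<sigma>) F(T, S\<sigma>)\<close> over all \<open>\<sigma>\<close>, so that
  moving \<open>\<sigma>\<close> to the other table exchanges them for odd \<open>d\<close> and preserves them for even \<open>d\<close>.
\<close>

section \<open>Inversion signs\<close>

text \<open>Defined over an arbitrary linear order because the same sign is taken of words, of lists
  of columns in lexicographic order, and of lists of pairs in the product order.\<close>

primrec inv_sign :: "'a::linorder list \<Rightarrow> complex" where
  "inv_sign [] = 1"
| "inv_sign (a # xs) = (\<Prod>b\<leftarrow>xs. if b < a then - 1 else 1) * inv_sign xs"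

lemma prod_list_signs:
  "(\<Prod>b\<leftarrow>xs. if P b then - 1 else 1 :: complex) = (- 1) ^ card {j. j < length xs \<and> P (xs ! j)}"
proof -
  have "(\<Prod>b\<leftarrow>xs. if P b then - 1 else 1 :: complex) = (- 1) ^ length (filter P xs)"
    by (induction xs) auto
  thus ?thesis by (simp add: length_filter_conv_card)
qed

lemma word_sign_Cons:
  "word_sign (a # w) = (\<Prod>b\<leftarrow>w. if b < a then - 1 else 1) * word_sign w"
proof -
  let ?I = "\<lambda>w::nat list. {(i, j). i < j \<and> j < length w \<and> w ! i > w ! j}"
  let ?J = "{j. j < length w \<and> w ! j < a}"
  have fin: "finite (?I w)"
    by (rule finite_subset[of _ "{..<length w} \<times> {..<length w}"]) auto
  have "?I (a # w) = (\<lambda>j. (0, Suc j)) ` ?J \<union> (\<lambda>(i, j). (Suc i, Suc j)) ` ?I w" (is "?l = ?r")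
  proof (intro set_eqI iffI)
    fix p assume "p \<in> ?l"
    then obtain i j where p: "p = (i, j)" and h: "i < j" "j < Suc (length w)" "(a # w) ! j < (a # w) ! i"
      by auto
    obtain j' where j': "j = Suc j'" using h(1) by (cases j) auto
    show "p \<in> ?r"
    proof (cases i)
      case 0
      thus ?thesis using p h j' by auto
    next
      case (Suc i')
      hence "(i', j') \<in> ?I w" using h j' by auto
      thus ?thesis using p Suc j' by (intro UnI2 image_eqI[of _ _ "(i', j')"]) auto
    qed
  qed auto
  moreover have "card ((\<lambda>j. (0::nat, Suc j)) ` ?J \<union> (\<lambda>(i, j). (Suc i, Suc j)) ` ?I w) = card ?J + card (?I w)"
    using fin by (subst card_Un_disjoint) (auto simp: card_image inj_on_def)
  ultimately show ?thesis
    by (simp add: word_sign_def prod_list_signs power_add)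
qed

lemma word_sign_eq_inv_sign: "word_sign w = inv_sign w"
  by (induction w) (simp_all add: word_sign_Cons, simp add: word_sign_def)

lemma inv_sign_square: "inv_sign xs * inv_sign xs = 1"
proof (induction xs)
  case (Cons a xs)
  have "(\<Prod>b\<leftarrow>xs. if b < a then - 1 else 1 :: complex) * (\<Prod>b\<leftarrow>xs. if b < a then - 1 else 1) = 1"
    by (simp add: prod_list_signs flip: power_add)
  thus ?case using Cons by (simp add: algebra_simps)
qed simp

lemma inv_sign_sorted: "sorted xs \<Longrightarrow> inv_sign xs = 1"
proof (induction xs)
  case (Cons a xs)
  have "(\<Prod>b\<leftarrow>xs. if b < a then - 1 else 1 :: complex) = (\<Prod>b\<leftarrow>xs. 1)"
    using Cons.prems by (intro arg_cong[of _ _ prod_list] map_cong) auto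
  thus ?case using Cons by (simp add: map_replicate_const)
qed simp

section \<open>Inversion signs under permutation of the entries\<close>

lemma inv_sign_swap_adjacent:
  "a \<noteq> b \<Longrightarrow> inv_sign (us @ a # b # ws) = - inv_sign (us @ b # a # ws)"
  by (induction us) (auto simp: mult_ac)

text \<open>A distant exchange is a shorter one conjugated by adjacent exchanges:
  \<open>x v .. y\<close>, \<open>v x .. y\<close>, \<open>v y .. x\<close>,
  \<open>y v .. x\<close>. These are three sign changes.\<close>

lemma inv_sign_swap:
  assumes "distinct (us @ x # vs @ y # ws)"
  shows "inv_sign (us @ x # vs @ y # ws) = - inv_sign (us @ y # vs @ x # ws)"
  using assms
proof (induction vs arbitrary: us)
  case Nil
  thus ?case by (auto intro: inv_sign_swap_adjacent)
next
  case (Cons v vs)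
  have "inv_sign (us @ x # (v # vs) @ y # ws) = - inv_sign ((us @ [v]) @ x # vs @ y # ws)"
    using Cons.prems inv_sign_swap_adjacent[of x v us "vs @ y # ws"] by auto
  also have "\<dots> = inv_sign ((us @ [v]) @ y # vs @ x # ws)"
    using Cons.prems by (subst Cons.IH) auto
  also have "\<dots> = - inv_sign (us @ y # (v # vs) @ x # ws)"
    using Cons.prems inv_sign_swap_adjacent[of v y us "vs @ x # ws"] by auto
  finally show ?case .
qed

lemma inv_sign_transposition:
  assumes "distinct xs" "a < b" "b < length xs"
  shows "inv_sign (permute_list (Transposition.transpose a b) xs) = - inv_sign xs"
proof -
  define us vs ws where "us = take a xs" and "vs = take (b - Suc a) (drop (Suc a) xs)"
    and "ws = drop (Suc b) xs"
  have "drop (Suc a) xs = vs @ drop (b - Suc a) (drop (Suc a) xs)"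
    by (simp only: vs_def append_take_drop_id)
  also have "drop (b - Suc a) (drop (Suc a) xs) = xs ! b # ws"
    using assms by (simp add: ws_def Cons_nth_drop_Suc)
  finally have d: "drop (Suc a) xs = vs @ xs ! b # ws" .
  have xs: "xs = us @ xs ! a # vs @ xs ! b # ws"
    using assms by (simp add: us_def flip: d add: Cons_nth_drop_Suc)
  have la: "length us = a" and lb: "length vs = b - Suc a"
    using assms by (simp_all add: us_def vs_def)
  have "permute_list (Transposition.transpose a b) xs = us @ xs ! b # vs @ xs ! a # ws"
  proof (rule nth_equalityI)
    show len: "length (permute_list (Transposition.transpose a b) xs) = length (us @ xs ! b # vs @ xs ! a # ws)"
      using arg_cong[OF xs, of length] by simp
    fix i assume "i < length (permute_list (Transposition.transpose a b) xs)"
    hence i: "i < length xs" by simp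
    have "(us @ xs ! b # vs @ xs ! a # ws) ! i = xs ! Transposition.transpose a b i"
    proof (cases "i = a \<or> i = b")
      case True
      thus ?thesis using la lb assms(2) by (auto simp: nth_append nth_Cons')
    next
      case False
      hence "xs ! i = (us @ xs ! b # vs @ xs ! a # ws) ! i"
        using la lb assms(2) by (subst xs) (auto simp: nth_append nth_Cons')
      thus ?thesis using False by (simp add: transpose_def)
    qed
    thus "permute_list (Transposition.transpose a b) xs ! i = (us @ xs ! b # vs @ xs ! a # ws) ! i"
      using i by (simp add: permute_list_def)
  qed
  moreover have "distinct (us @ xs ! a # vs @ xs ! b # ws)"
    using assms(1) by (simp add: xs[symmetric])
  ultimately show ?thesis using inv_sign_swap[of us "xs ! a" vs "xs ! b" ws]
    by (simp add: xs[symmetric])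
qed

text \<open>Induction over transpositions. Since \<open>permute_list\<close> reverses composition,
  the newly added transposition acts on the list before \<open>p\<close> does; therefore the claim
  is proved for all distinct lists of a fixed length \<open>k\<close>.\<close>

lemma inv_sign_permute_list:
  assumes "p permutes {..<length xs}" "distinct xs"
  shows "inv_sign (permute_list p xs) = of_int (sign p) * inv_sign xs"
proof -
  have "length xs = k \<Longrightarrow> distinct xs \<Longrightarrow> inv_sign (permute_list p xs) = of_int (sign p) * inv_sign xs"
    if "p permutes {..<k}" for k
    using that finite_lessThan[of k]
  proof (induction arbitrary: xs rule: permutes_induct)
    case id
    thus ?case by simp
  next
    case (swap a b p)
    let ?t = "Transposition.transpose a b"
    let ?ys = "permute_list ?t xs"
    have t: "?t permutes {..<length xs}" using swap by (auto intro: permutes_swap_id)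
    have "permutation p" using swap by (metis finite_lessThan permutation_permutes)
    hence s: "sign (?t \<circ> p) = - sign p"
      using swap by (simp add: sign_compose sign_swap_id permutation_swap_id)
    have "inv_sign ?ys = - inv_sign xs"
      using swap inv_sign_transposition[of xs a b] inv_sign_transposition[of xs b a]
      by (cases a b rule: linorder_cases) (auto simp: transpose_commute)
    moreover have "distinct ?ys" "length ?ys = k" using t swap by simp_all
    moreover have "permute_list (?t \<circ> p) xs = permute_list p ?ys"
      using swap by (simp add: permute_list_compose)
    ultimately show ?case using swap.IH[of ?ys] s by (simp add: o_def)
  qed
  thus ?thesis using assms by blast
qed

text \<open>A zero prepended to \<open>a\<close> is not part of any inversion, and it turns the one-based one-line
  notation of the permutation into the zero-based one of \<^const>\<open>permute_list\<close>.\<close>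

lemma perm_sgn_eq_inv_sign:
  "perm_sgn a = (if distinct a \<and> set a = {1..length a} then inv_sign a else 0)"
proof (cases "distinct a \<and> set a = {1..length a}")
  case True
  define p where "p = (\<lambda>i. if i \<in> {1..length a} then a ! (i - 1) else i)"
  have "bij_betw (\<lambda>i. a ! (i - 1)) {1..length a} {1..length a}"
  proof -
    have "bij_betw ((!) a) {..<length a} {1..length a}"
      using True bij_betw_nth[of a "{..<length a}" "{1..length a}"] by simp
    moreover have "bij_betw (\<lambda>i. i - 1) {1..length a} {..<length a}"
      by (rule bij_betwI[of _ _ _ Suc]) auto
    ultimately show ?thesis by (auto dest: bij_betw_trans simp: o_def)
  qed
  hence "bij_betw p {1..length a} {1..length a}"
    by (rule bij_betw_cong[THEN iffD1, rotated]) (simp add: p_def)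
  hence p: "p permutes {1..length a}"
    by (rule bij_imp_permutes) (simp only: p_def if_False)
  hence p': "p permutes {..<Suc (length a)}"
    by (rule permutes_subset) auto
  have "0 # a = permute_list p [0..<Suc (length a)]"
  proof (rule nth_equalityI)
    fix i assume "i < length (0 # a)"
    hence i: "i < Suc (length a)" by simp
    hence "p i < Suc (length a)" using permutes_in_image[OF p', of i] by simp
    thus "(0 # a) ! i = permute_list p [0..<Suc (length a)] ! i"
      using i p' by (subst permute_list_nth) (auto simp: p_def nth_Cons' simp del: upt_Suc)
  qed (simp del: upt_Suc)
  moreover have "inv_sign [0..<Suc (length a)] = 1" by (rule inv_sign_sorted) (rule sorted_upt)
  moreover have "inv_sign (permute_list p [0..<Suc (length a)])
      = of_int (sign p) * inv_sign [0..<Suc (length a)]"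
    using p' by (intro inv_sign_permute_list) (simp_all del: upt_Suc)
  ultimately have "inv_sign (0 # a) = of_int (sign p)" by simp
  moreover have "inv_sign (0 # a) = inv_sign a"
    by (simp add: map_replicate_const)
  ultimately show ?thesis using True by (simp add: perm_sgn_def p_def)
qed (auto simp: perm_sgn_def)

text \<open>Multiplying by a generator from the left produces a sign for each smaller entry that
  follows it, which is the recursion of \<open>inv_sign\<close>; a repeated generator gives
  zero.\<close>

lemma ext_word_eq_single:
  "ext_word cs = (if distinct cs then Poly_Mapping.single (fset_of_list cs) (inv_sign cs) else 0)"
proof (induction cs)
  case Nil
  thus ?case by (simp add: ext_word_def ext_one_def)
next
  case (Cons c cs)
  have eq: "ext_word (c # cs) = wedge (ext_gen c) (ext_word cs)" by (simp add: ext_word_def)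
  show ?case
  proof (cases "distinct cs")
    case True
    have "shuffle_sign {|c|} (fset_of_list cs) = (if c \<in> set cs then 0 else (\<Prod>b\<leftarrow>cs. if b < c then - 1 else 1))"
    proof (cases "c \<in> set cs")
      case False
      have "{(a, b). a |\<in>| {|c|} \<and> b |\<in>| fset_of_list cs \<and> b < a} = Pair c ` {b \<in> set cs. b < c}"
        by (auto simp: fset_of_list_elem)
      hence "card {(a, b). a |\<in>| {|c|} \<and> b |\<in>| fset_of_list cs \<and> b < a} = card {b \<in> set cs. b < c}"
        by (simp add: card_image inj_on_def)
      also have "\<dots> = length (filter (\<lambda>b. b < c) cs)"
        using True by (metis distinct_card distinct_filter set_filter)
      finally show ?thesis using False
        by (simp only: shuffle_sign_def prod_list_signs length_filter_conv_card)
           (auto simp: fset_of_list_elem)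
    qed (auto simp: shuffle_sign_def fset_of_list_elem)
    thus ?thesis using True Cons by (simp add: eq ext_gen_def wedge_single)
  qed (simp add: eq Cons)
qed

section \<open>The sign of a pair of words\<close>

definition row_form :: "nat list \<Rightarrow> nat list \<Rightarrow> complex" where
  "row_form s x = word_sign s * word_sgn s x"

text \<open>The diagram whose row \<open>c\<close> has one cell for each occurrence of
  \<open>c\<close> in \<open>s\<close>; for words of content \<alpha> it depends on \<alpha>
  only.\<close>

definition word_cells :: "nat list \<Rightarrow> (nat \<times> nat) set" where
  "word_cells s = {(c, r). 1 \<le> r \<and> r \<le> count_list s c}"

lemma nths_letter_positions:
  "length s = length x \<Longrightarrow>
     nths x {b. b < length s \<and> s ! b = c} = map snd (filter (\<lambda>p. fst p = c) (zip s x))"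
  by (induction s x rule: list_induct2) (simp_all add: nths_Cons)

text \<open>In the product order two pairs are inverted iff their first components are, or these
  agree and the second components are inverted. The latter inversions are collected letter by
  letter. The index set \<open>C\<close> stays fixed while the list shrinks; letters that do not
  occur contribute 1.\<close>

lemma inv_sign_pairs:
  assumes "finite C" "fst ` set ps \<subseteq> C"
  shows "inv_sign (map fst ps) * (\<Prod>c\<in>C. inv_sign (map snd (filter (\<lambda>p. fst p = c) ps))) = inv_sign ps"
  using assms(2)
proof (induction ps)
  case (Cons p ps)
  obtain c0 r0 where p: "p = (c0, r0)" by (cases p)
  let ?g = "\<lambda>ps c. inv_sign (map snd (filter (\<lambda>p. fst p = c) ps))"
  let ?k = "\<Prod>b\<leftarrow>map snd (filter (\<lambda>p. fst p = c0) ps). if b < r0 then - 1 else 1 :: complex"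
  have c0: "c0 \<in> C" using Cons.prems p by simp
  have "(\<Prod>c\<in>C. ?g (p # ps) c) = (\<Prod>c\<in>C. (if c = c0 then ?k else 1) * ?g ps c)"
    by (rule prod.cong) (auto simp: p)
  also have "\<dots> = ?k * (\<Prod>c\<in>C. ?g ps c)"
    using c0 assms(1) by (simp add: prod.distrib prod.delta)
  finally have 1: "(\<Prod>c\<in>C. ?g (p # ps) c) = ?k * (\<Prod>c\<in>C. ?g ps c)" .
  have 2: "(\<Prod>b\<leftarrow>map fst ps. if b < c0 then - 1 else 1) * ?k = (\<Prod>b\<leftarrow>ps. if b < p then - 1 else 1)"
    by (induction ps) (auto simp: p less_prod_def')
  have "inv_sign (map fst (p # ps)) * (\<Prod>c\<in>C. ?g (p # ps) c)
      = ((\<Prod>b\<leftarrow>map fst ps. if b < c0 then - 1 else 1) * ?k) * (inv_sign (map fst ps) * (\<Prod>c\<in>C. ?g ps c))"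
    by (subst 1) (simp add: p)
  also have "\<dots> = inv_sign (p # ps)"
    using Cons by (subst 2) simp
  finally show ?case .
qed simp

lemma distinct_pairs_iff:
  "distinct ps \<longleftrightarrow> (\<forall>c\<in>fst ` set ps. distinct (map snd (filter (\<lambda>p. fst p = c) ps)))"
proof
  assume "distinct ps"
  thus "\<forall>c\<in>fst ` set ps. distinct (map snd (filter (\<lambda>p. fst p = c) ps))"
    by (auto simp: distinct_map inj_on_def)
next
  assume *: "\<forall>c\<in>fst ` set ps. distinct (map snd (filter (\<lambda>p. fst p = c) ps))"
  have "distinct (map snd (filter (\<lambda>p. fst p = c) ps))" for c
  proof (cases "c \<in> fst ` set ps")
    case False
    hence "filter (\<lambda>p. fst p = c) ps = []" by (auto simp: filter_empty_conv)
    thus ?thesis by simp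
  qed (use * in blast)
  thus "distinct ps"
  proof (induction ps)
    case (Cons p ps)
    have "distinct (map snd (filter (\<lambda>p. fst p = c) ps))" for c
      using Cons.prems[of c] by (simp split: if_splits)
    moreover have "p \<notin> set ps" using Cons.prems[of "fst p"] by force
    ultimately show ?case using Cons.IH by simp
  qed simp
qed

text \<open>The entries below a letter \<open>c\<close> number \<open>count_list s c\<close>, so
  \<open>perm_sgn\<close> is nonzero on them iff they are 1, ..., \<open>count_list s c\<close> in
  some order. Over all letters this says that the pairs enumerate the cells, and
  \<open>inv_sign_pairs\<close> assembles the sign.\<close>

lemma row_form_eq:
  assumes "length s = length x"
  shows "row_form s x =
    (if distinct (zip s x) \<and> set (zip s x) = word_cells s then inv_sign (zip s x) else 0)"
proof -
  let ?ps = "zip s x"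
  let ?N = "\<lambda>c. map snd (filter (\<lambda>p. fst p = c) ?ps)"
  have fst: "map fst ?ps = s" using assms by simp
  hence img: "fst ` set ?ps = set s" by (metis set_map)
  have len: "length (?N c) = count_list s c" for c
  proof -
    have "length (?N c) = length (filter (\<lambda>y. y = c) (map fst ?ps))"
      by (simp add: filter_map o_def)
    also have "\<dots> = count_list s c"
      unfolding fst count_list_eq_length_filter by (rule arg_cong[of _ _ length], rule filter_cong) auto
    finally show ?thesis .
  qed
  have cells: "(\<forall>c\<in>set s. set (?N c) = {1..count_list s c}) \<longleftrightarrow> set ?ps = word_cells s"
  proof
    assume *: "\<forall>c\<in>set s. set (?N c) = {1..count_list s c}"
    show "set ?ps = word_cells s"
    proof (intro set_eqI, clarify)
      fix c r
      show "(c, r) \<in> set ?ps \<longleftrightarrow> (c, r) \<in> word_cells s"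
      proof (cases "c \<in> set s")
        case True
        hence "r \<in> set (?N c) \<longleftrightarrow> 1 \<le> r \<and> r \<le> count_list s c" using * by simp
        moreover have "r \<in> set (?N c) \<longleftrightarrow> (c, r) \<in> set ?ps" by force
        ultimately show ?thesis by (simp add: word_cells_def)
      next
        case False
        hence "count_list s c = 0" by (simp add: count_list_0_iff)
        moreover have "(c, r) \<notin> set ?ps" using False by (auto dest: set_zip_leftD)
        ultimately show ?thesis by (simp add: word_cells_def)
      qed
    qed
  next
    assume *: "set ?ps = word_cells s"
    have "set (?N c) = {r. (c, r) \<in> word_cells s}" for c
      by (subst *[symmetric]) force
    thus "\<forall>c\<in>set s. set (?N c) = {1..count_list s c}" by (auto simp: word_cells_def)
  qed
  have "word_sgn s x = (\<Prod>c\<in>set s. perm_sgn (?N c))"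
    by (simp add: word_sgn_def nths_letter_positions[OF assms])
  also have "\<dots> = (\<Prod>c\<in>set s. if distinct (?N c) \<and> set (?N c) = {1..count_list s c} then inv_sign (?N c) else 0)"
    by (simp only: perm_sgn_eq_inv_sign len)
  also have "\<dots> = (if \<forall>c\<in>set s. distinct (?N c) \<and> set (?N c) = {1..count_list s c}
      then \<Prod>c\<in>set s. inv_sign (?N c) else 0)"
    by (auto intro!: prod_zero)
  also have "(\<forall>c\<in>set s. distinct (?N c) \<and> set (?N c) = {1..count_list s c}) \<longleftrightarrow>
      distinct ?ps \<and> set ?ps = word_cells s"
    unfolding distinct_pairs_iff img cells[symmetric] by blast
  finally show ?thesis
    using inv_sign_pairs[of "set s" ?ps] img fst
    by (simp add: row_form_def word_sign_eq_inv_sign)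
qed

lemma count_list_permute_list:
  assumes "p permutes {..<length s}"
  shows "count_list (permute_list p s) c = count_list s c"
  using mset_permute_list[OF assms] by (metis count_mset)

lemma row_form_permute_list:
  assumes "length s = length x" "p permutes {..<length x}"
  shows "row_form (permute_list p s) (permute_list p x) = of_int (sign p) * row_form s x"
proof -
  have z: "zip (permute_list p s) (permute_list p x) = permute_list p (zip s x)"
    using assms by (intro permute_list_zip[symmetric]) auto
  have p: "p permutes {..<length (zip s x)}" using assms by simp
  have c: "word_cells (permute_list p s) = word_cells s"
    using assms by (simp add: word_cells_def count_list_permute_list)
  show ?thesis
    using assms p inv_sign_permute_list[OF p] by (simp add: row_form_eq z c)
qed

section \<open>Conjugate partitions\<close>

text \<open>Says cell by cell that the two diagrams are transposes of each other. The relation is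
  visibly symmetric, so a partition and its conjugate can exchange roles without an appeal to
  \<open>conjugate\<close> being an involution.\<close>

definition dual_parts :: "nat list \<Rightarrow> nat list \<Rightarrow> bool" where
  "dual_parts \<alpha> \<beta> \<longleftrightarrow> (\<forall>r\<ge>1. \<forall>c\<ge>1. c \<le> part \<alpha> r \<longleftrightarrow> r \<le> part \<beta> c)"

lemma dual_parts_sym: "dual_parts \<alpha> \<beta> \<Longrightarrow> dual_parts \<beta> \<alpha>"
  by (auto simp: dual_parts_def)

lemma part_0 [simp]: "part \<alpha> 0 = 0"
  by (simp add: part_def)

lemma part_map_upt: "part (map f [1..<Suc k]) c = (if 1 \<le> c \<and> c \<le> k then f c else 0)"
  by (auto simp: part_def simp del: upt_Suc)

text \<open>The parts weakly decrease, so the rows with at least \<open>c\<close> cells are an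
  initial segment of all rows; row \<open>r\<close> belongs to it iff its length is at least
  \<open>r\<close>.\<close>

lemma dual_parts_conjugate:
  assumes "partition_of m \<mu>"
  shows "dual_parts \<mu> (conjugate \<mu>)"
  unfolding dual_parts_def
proof (intro allI impI)
  fix r c :: nat assume rc: "1 \<le> r" "1 \<le> c"
  have mono: "part \<mu> j \<le> part \<mu> i" if "1 \<le> i" "i \<le> j" for i j
    using that assms
    by (cases "i = j") (auto simp: part_def partition_of_def sorted_wrt_iff_nth_less)
  let ?I = "{i. 1 \<le> i \<and> i \<le> length \<mu> \<and> c \<le> part \<mu> i}"
  have I: "?I = {i. 1 \<le> i \<and> c \<le> part \<mu> i}" using rc by (auto simp: part_def split: if_splits)
  have fin: "finite ?I" by (rule finite_subset[of _ "{..length \<mu>}"]) auto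
  have "part (conjugate \<mu>) c = card ?I"
  \<comment> \<open>For \<open>c\<close> beyond the first part the list
    \<open>conjugate \<mu>\<close> has ended and \<open>part\<close> takes its default value 0, in
    agreement with the empty set of rows.\<close>
  proof (cases "c \<le> part \<mu> 1")
    case True
    thus ?thesis unfolding conjugate_def part_map_upt using rc by simp
  next
    case False
    hence "?I = {}" using I mono[of 1] by (auto dest: order_trans)
    thus ?thesis unfolding conjugate_def part_map_upt using False by (simp only: card.empty) simp
  qed
  also have "r \<le> card ?I \<longleftrightarrow> c \<le> part \<mu> r"
  proof
    assume "c \<le> part \<mu> r"
    hence "{1..r} \<subseteq> ?I" unfolding I using mono order_trans by fastforce
    hence "card {1..r} \<le> card ?I" using fin by (rule card_mono[rotated])
    thus "r \<le> card ?I" by simp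
  next
    assume r: "r \<le> card ?I"
    show "c \<le> part \<mu> r"
    proof (rule ccontr)
      assume *: "\<not> c \<le> part \<mu> r"
      have "?I \<subseteq> {1..<r}"
      proof
        fix i assume i: "i \<in> ?I"
        have "i < r"
        proof (rule ccontr)
          assume "\<not> i < r"
          hence "part \<mu> i \<le> part \<mu> r" using rc mono by simp
          thus False using i * by simp
        qed
        thus "i \<in> {1..<r}" using i by simp
      qed
      hence "card ?I \<le> card {1..<r}" by (intro card_mono) auto
      thus False using r rc by simp
    qed
  qed
  finally show "c \<le> part \<mu> r \<longleftrightarrow> r \<le> part (conjugate \<mu>) c" by simp
qed

lemma word_cells_words: "s \<in> words \<alpha> \<Longrightarrow> word_cells s = {(c, r). 1 \<le> r \<and> r \<le> part \<alpha> c}"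
  by (simp add: word_cells_def words_def)

lemma part_pos_imp: "part \<alpha> c > 0 \<Longrightarrow> 1 \<le> c \<and> c \<le> length \<alpha>"
  by (simp add: part_def split: if_splits)

lemma sum_part: "(\<Sum>c=1..length \<alpha>. part \<alpha> c) = sum_list \<alpha>"
proof -
  have "(\<Sum>c=1..length \<alpha>. part \<alpha> c) = (\<Sum>c<length \<alpha>. \<alpha> ! c)"
    by (rule sum.reindex_bij_witness[of _ Suc "\<lambda>c. c - 1"]) (auto simp: part_def)
  thus ?thesis by (simp add: sum_list_sum_nth lessThan_atLeast0)
qed

text \<open>A nonzero sign means that the pairs enumerate the cells, so the number of entries equal
  to \<open>c\<close> is the length of column \<open>c\<close>, which is
  \<open>part \<beta> c\<close>.\<close>

lemma row_form_support:
  assumes "dual_parts \<alpha> \<beta>" "s \<in> words \<alpha>" "length s = length x" "row_form s x \<noteq> 0"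
  shows "x \<in> words \<beta>"
proof -
  let ?ps = "zip s x"
  have d: "distinct ?ps" and st: "set ?ps = word_cells s"
    using assms by (auto simp: row_form_eq split: if_splits)
  have st: "set ?ps = {(c, r). 1 \<le> r \<and> r \<le> part \<alpha> c}"
    using st assms(2) by (simp add: word_cells_words)
  have cnt: "count_list x c = part \<beta> c" for c
  proof -
    have "count_list (map snd ?ps) c = length (filter (\<lambda>p. snd p = c) ?ps)"
      by (induction ?ps) (auto simp: count_list_eq_length_filter filter_map o_def eq_commute)
    also have "\<dots> = card {p \<in> set ?ps. snd p = c}"
      using d by (metis distinct_card distinct_filter set_filter)
    also have "{p \<in> set ?ps. snd p = c} = (\<lambda>r. (r, c)) ` {1..part \<beta> c}"
    \<comment> \<open>\<open>dual_parts\<close> speaks of positive indices only. At 0 both sides are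
      empty, since cells start at 1 and \<open>part\<close> vanishes there.\<close>
    proof (cases "c = 0")
      case True
      thus ?thesis by (auto simp: st)
    next
      case False
      hence c: "c \<ge> 1" by simp
      show ?thesis
      proof (intro set_eqI iffI)
        fix p assume "p \<in> {p \<in> set ?ps. snd p = c}"
        then obtain r where r: "p = (r, c)" "c \<le> part \<alpha> r" by (auto simp: st)
        hence "r \<ge> 1" using c part_pos_imp[of \<alpha> r] by linarith
        hence "r \<le> part \<beta> c" using assms(1) c r by (simp add: dual_parts_def)
        thus "p \<in> (\<lambda>r. (r, c)) ` {1..part \<beta> c}" using r \<open>r \<ge> 1\<close> by auto
      next
        fix p assume "p \<in> (\<lambda>r. (r, c)) ` {1..part \<beta> c}"
        thus "p \<in> {p \<in> set ?ps. snd p = c}" using assms(1) c by (auto simp: st dual_parts_def)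
      qed
    qed
    also have "card \<dots> = part \<beta> c" by (simp add: card_image inj_on_def)
    finally show ?thesis using assms(3) by simp
  qed
  have "set x \<subseteq> {1..length \<beta>}"
  proof
    fix c assume "c \<in> set x"
    hence "count_list x c \<noteq> 0" by (simp add: count_list_0_iff)
    thus "c \<in> {1..length \<beta>}" using part_pos_imp[of \<beta> c] by (simp add: cnt)
  qed
  hence "length x = (\<Sum>c=1..length \<beta>. part \<beta> c)"
    by (simp add: cnt flip: sum_count_set)
  thus ?thesis unfolding sum_part by (simp add: words_def cnt)
qed

section \<open>The sign of transposing a diagram\<close>

text \<open>Reordering the list multiplies both factors by the same sign, which squares to 1. So the
  product depends only on the set of cells.\<close>

lemma inv_sign_swap_pairs_cong:
  assumes "distinct ps" "distinct qs" "set ps = set qs"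
  shows "inv_sign ps * inv_sign (map prod.swap ps) = inv_sign qs * inv_sign (map prod.swap qs)"
proof -
  have "mset ps = mset qs" using assms by (simp add: set_eq_iff_mset_eq_distinct)
  then obtain p where p: "p permutes {..<length qs}" "permute_list p qs = ps"
    by (rule mset_eq_permutation)
  have "distinct (map prod.swap qs)" using assms by (simp add: distinct_map)
  hence "inv_sign (map prod.swap ps) = of_int (sign p) * inv_sign (map prod.swap qs)"
    using p inv_sign_permute_list[of p "map prod.swap qs"] by (simp add: permute_list_map)
  moreover have "inv_sign ps = of_int (sign p) * inv_sign qs"
    using p assms inv_sign_permute_list[of p qs] by simp
  moreover have "of_int (sign p) * of_int (sign p) = (1 :: complex)"
    by (simp flip: of_int_mult)
  ultimately show ?thesis by (simp add: mult_ac)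
qed

text \<open>The diagram read row by row; the second components spell the word that defines
  \<open>partition_sign\<close>.\<close>

definition cell_list :: "nat list \<Rightarrow> (nat \<times> nat) list" where
  "cell_list \<mu> = concat (map (\<lambda>r. map (Pair r) [1..<Suc (part \<mu> r)]) [1..<Suc (length \<mu>)])"

lemma set_cell_list: "set (cell_list \<mu>) = {(r, c). 1 \<le> c \<and> c \<le> part \<mu> r}"
  by (force simp: cell_list_def part_def simp del: upt_Suc split: if_splits)

lemma sorted_wrt_cells:
  "sorted_wrt (<) rs \<Longrightarrow> sorted_wrt (<) (concat (map (\<lambda>r::nat. map (Pair r) [1..<Suc (f r)]) rs))"
proof (induction rs)
  case (Cons r rs)
  have "sorted_wrt (<) (map (Pair r) [1..<Suc (f r)])"
    by (simp add: sorted_wrt_map del: upt_Suc)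
  thus ?case using Cons by (auto simp: sorted_wrt_append simp del: upt_Suc)
qed simp

text \<open>Of two cells with equal second component the earlier has the smaller first component, so
  ties cause no inversion after the exchange of components.\<close>

lemma inv_sign_map_swap_sorted:
  "sorted_wrt (<) ps \<Longrightarrow> inv_sign (map prod.swap ps) = inv_sign (map snd ps)"
proof (induction ps)
  case (Cons p ps)
  have "(\<Prod>b\<leftarrow>map prod.swap ps. if b < prod.swap p then - 1 else 1 :: complex)
      = (\<Prod>b\<leftarrow>map snd ps. if b < snd p then - 1 else 1)"
    unfolding map_map o_def using Cons.prems
    by (intro arg_cong[of _ _ prod_list] map_cong) (auto simp: less_prod_def')
  thus ?case using Cons by simp
qed simp

text \<open>The row reading is increasing, so its own sign is 1. That factor is kept to give the
  product the form that \<open>inv_sign_swap_pairs_cong\<close> transports to any other enumeration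
  of the cells.\<close>

lemma partition_sign_eq:
  "partition_sign \<mu> = inv_sign (cell_list \<mu>) * inv_sign (map prod.swap (cell_list \<mu>))"
proof -
  have s: "sorted_wrt (<) (cell_list \<mu>)"
    unfolding cell_list_def by (rule sorted_wrt_cells) (simp del: upt_Suc)
  have "map (part \<mu>) [1..<Suc (length \<mu>)] = \<mu>"
    by (rule nth_equalityI) (auto simp: part_def simp del: upt_Suc)
  hence "concat (map (\<lambda>p. [1..<Suc p]) \<mu>) = concat (map (\<lambda>p. [1..<Suc p]) (map (part \<mu>) [1..<Suc (length \<mu>)]))"
    by simp
  also have "\<dots> = map snd (cell_list \<mu>)"
    by (simp add: cell_list_def map_concat o_def del: upt_Suc)
  finally have "partition_sign \<mu> = inv_sign (map snd (cell_list \<mu>))"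
    by (simp add: partition_sign_def word_sign_eq_inv_sign)
  moreover have "inv_sign (cell_list \<mu>) = 1"
    using s by (intro inv_sign_sorted) (simp add: strict_sorted_iff)
  ultimately show ?thesis by (simp add: inv_sign_map_swap_sorted[OF s])
qed

text \<open>Exchanging the words transposes every pair and the diagram with it, so both forms vanish
  together. Otherwise \<open>zip s t\<close> enumerates the same cells as
  \<open>cell_list \<mu>\<close>, and the product of the signs in the two orders is
  \<open>partition_sign \<mu>\<close>.\<close>

lemma row_form_swap:
  assumes "dual_parts \<mu> \<beta>" "s \<in> words \<mu>" "t \<in> words \<beta>" "length s = length t"
  shows "row_form s t = partition_sign \<mu> * row_form t s"
proof -
  have z: "zip t s = map prod.swap (zip s t)"
    by (metis zip_commute prod.swap_def case_prod_beta' map_eq_conv)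
  have conv: "(r, c) \<in> word_cells s \<longleftrightarrow> (c, r) \<in> word_cells t" for r c
  proof -
    have "1 \<le> r" if "1 \<le> c" "c \<le> part \<mu> r" using that part_pos_imp[of \<mu> r] by linarith
    moreover have "1 \<le> c" if "1 \<le> r" "r \<le> part \<beta> c" using that part_pos_imp[of \<beta> c] by linarith
    ultimately show ?thesis using assms
      by (auto simp: word_cells_words dual_parts_def)
  qed
  have "distinct (zip t s) \<longleftrightarrow> distinct (zip s t)" by (simp add: z distinct_map)
  moreover have "set (zip t s) = word_cells t \<longleftrightarrow> set (zip s t) = word_cells s"
  proof -
    have "word_cells t = prod.swap ` word_cells s" by (auto simp: set_eq_iff conv)
    thus ?thesis by (simp add: z inj_image_eq_iff)
  qed
  moreover have "inv_sign (zip s t) = partition_sign \<mu> * inv_sign (zip t s)"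
    if "distinct (zip s t)" "set (zip s t) = word_cells s"
  proof -
    have "distinct (cell_list \<mu>)"
      using sorted_wrt_cells[of "[1..<Suc (length \<mu>)]" "part \<mu>"]
      by (simp add: cell_list_def strict_sorted_iff del: upt_Suc)
    hence "partition_sign \<mu> = inv_sign (zip s t) * inv_sign (zip t s)"
      unfolding partition_sign_eq z using that assms(2)
      by (intro inv_sign_swap_pairs_cong) (simp_all add: set_cell_list word_cells_words)
    thus ?thesis using inv_sign_square[of "zip t s"] by (simp add: mult.assoc)
  qed
  ultimately show ?thesis using assms(4) by (simp add: row_form_eq)
qed

lemma dual_parts_sum_list:
  assumes "dual_parts \<alpha> \<beta>"
  shows "sum_list \<beta> = sum_list \<alpha>"
proof -
  have s: "sum_list \<gamma> = card {(c, r). 1 \<le> r \<and> r \<le> part \<gamma> c}" for \<gamma>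
  proof -
    have "{(c, r). 1 \<le> r \<and> r \<le> part \<gamma> c} = (SIGMA c:{1..length \<gamma>}. {1..part \<gamma> c})"
      using part_pos_imp[of \<gamma>] by force
    thus ?thesis by (simp add: card_SigmaI flip: sum_part)
  qed
  have "(1 \<le> r \<and> r \<le> part \<beta> c) \<longleftrightarrow> (1 \<le> c \<and> c \<le> part \<alpha> r)" for r c
    using assms part_pos_imp[of \<alpha> r] part_pos_imp[of \<beta> c] unfolding dual_parts_def
    by (metis Suc_le_eq One_nat_def order_less_le_trans)
  hence "{(c, r). 1 \<le> r \<and> r \<le> part \<beta> c} = {(c, r). 1 \<le> c \<and> c \<le> part \<alpha> r}" by simp
  also have "\<dots> = prod.swap ` {(r, c). 1 \<le> c \<and> c \<le> part \<alpha> r}" by force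
  finally have "{(c, r). 1 \<le> r \<and> r \<le> part \<beta> c} = prod.swap ` {(r, c). 1 \<le> c \<and> c \<le> part \<alpha> r}" .
  thus ?thesis by (simp add: s card_image)
qed

lemma length_conjugate: "length (conjugate \<mu>) = part \<mu> 1"
  by (simp add: conjugate_def)

lemma words_entries:
  assumes "w \<in> words \<alpha>"
  shows "set w \<subseteq> {1..length \<alpha>}"
proof
  fix c assume "c \<in> set w"
  hence "count_list w c \<noteq> 0" by (simp add: count_list_0_iff)
  thus "c \<in> {1..length \<alpha>}" using assms part_pos_imp[of \<alpha> c] by (simp add: words_def)
qed

lemma words_permute_list:
  "w \<in> words \<alpha> \<Longrightarrow> p permutes {..<length w} \<Longrightarrow> permute_list p w \<in> words \<alpha>"
  by (simp add: words_def count_list_permute_list)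

section \<open>Column permutations of tables\<close>

definition rect :: "nat \<Rightarrow> nat \<Rightarrow> table \<Rightarrow> bool" where
  "rect d m T \<longleftrightarrow> length T = d \<and> (\<forall>t\<in>set T. length t = m)"

definition col_perm :: "(nat \<Rightarrow> nat) \<Rightarrow> table \<Rightarrow> table" where
  "col_perm p T = map (permute_list p) T"

lemma rect_col_perm [simp]: "rect d m (col_perm p T) \<longleftrightarrow> rect d m T"
  by (simp add: rect_def col_perm_def)

lemma tables_imp_rect: "X \<in> tables d m n \<Longrightarrow> rect d m X"
  by (simp add: tables_def rect_def)

lemma finite_tables: "finite (tables d m n)"
proof (rule finite_subset)
  show "tables d m n \<subseteq> {X. set X \<subseteq> {x. set x \<subseteq> {1..n} \<and> length x = m} \<and> length X = d}"
    by (auto simp: tables_def)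
qed (intro finite_lists_length_eq finite_atLeastAtMost)

lemma length_transpose_rect:
  assumes "rect d m T" "d \<ge> 1"
  shows "length (List.transpose T) = m"
proof -
  have "map length T = replicate d m"
    using assms by (intro nth_equalityI) (auto simp: rect_def)
  hence "sorted (rev (map length T))" by simp
  moreover have "T \<noteq> []" "length (T ! 0) = m" using assms by (auto simp: rect_def)
  ultimately show ?thesis by (simp add: length_transpose_sorted)
qed

lemma nth_transpose_rect:
  assumes "rect d m T" "d \<ge> 1" "j < m"
  shows "List.transpose T ! j = map (\<lambda>t. t ! j) T"
proof -
  have "filter (\<lambda>t. j < length t) T = T" using assms by (auto simp: rect_def filter_id_conv)
  thus ?thesis using assms by (simp add: nth_transpose length_transpose_rect)
qed

lemma transpose_col_perm:
  assumes "rect d m T" "d \<ge> 1" "p permutes {..<m}"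
  shows "List.transpose (col_perm p T) = permute_list p (List.transpose T)"
proof (rule nth_equalityI)
  have r: "rect d m (col_perm p T)" using assms by simp
  show "length (List.transpose (col_perm p T)) = length (permute_list p (List.transpose T))"
    using assms r by (simp add: length_transpose_rect)
  fix j assume "j < length (List.transpose (col_perm p T))"
  hence j: "j < m" using assms r by (simp add: length_transpose_rect)
  hence pj: "p j < m" using permutes_in_image[OF assms(3), of j] by simp
  have "List.transpose (col_perm p T) ! j = map (\<lambda>t. t ! p j) T"
    unfolding nth_transpose_rect[OF r assms(2) j]
    using assms j by (auto simp: col_perm_def rect_def permute_list_nth)
  also have "\<dots> = permute_list p (List.transpose T) ! j"
    using assms j pj by (simp add: permute_list_nth length_transpose_rect[OF assms(1,2)] nth_transpose_rect[OF assms(1,2)])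
  finally show "List.transpose (col_perm p T) ! j = permute_list p (List.transpose T) ! j" .
qed

lemma transpose_rect_inj:
  assumes "rect d m S" "rect d m T" "d \<ge> 1" "List.transpose S = List.transpose T"
  shows "S = T"
proof (rule nth_equalityI)
  show "length S = length T" using assms by (simp add: rect_def)
  fix i assume i: "i < length S"
  have l: "length (S ! i) = m" "length (T ! i) = m" using assms i by (simp_all add: rect_def)
  show "S ! i = T ! i"
  proof (rule nth_equalityI)
    fix j assume "j < length (S ! i)"
    hence j: "j < m" using l by simp
    have "List.transpose S ! j ! i = List.transpose T ! j ! i" using assms by simp
    thus "S ! i ! j = T ! i ! j"
      unfolding nth_transpose_rect[OF assms(1,3) j] nth_transpose_rect[OF assms(2,3) j]
      using assms(1,2) i by (simp add: rect_def)
  qed (use l in simp)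
qed

lemma col_perm_compose:
  assumes "rect d m T" "q permutes {..<m}"
  shows "col_perm q (col_perm p T) = col_perm (p \<circ> q) T"
  using assms by (auto simp: col_perm_def rect_def permute_list_compose)

lemma col_perm_id [simp]: "col_perm id T = T"
  by (simp add: col_perm_def map_idI)

section \<open>Counting and summing over column rearrangements\<close>

text \<open>Translation by a permutation carries one fibre onto another, so all fibres have the same
  size. Their total is the factorial of the length and their number is the multinomial
  coefficient.\<close>

lemma card_permute_list_fiber:
  assumes "mset cs' = mset cs"
  shows "card {p. p permutes {..<length cs} \<and> permute_list p cs = cs'} =
    (\<Prod>c\<in>set cs. fact (count_list cs c))"
proof -
  let ?P = "{p. p permutes {..<length cs}}"
  define fib where "fib ds = {p. p permutes {..<length cs} \<and> permute_list p cs = ds}" for ds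
  have fib: "card (fib ds) = card (fib cs)" if ds: "mset ds = mset cs" for ds
  proof -
    from ds obtain q where q: "q permutes {..<length cs}" "permute_list q cs = ds"
      by (rule mset_eq_permutation)
    note qi = permutes_inv[OF q(1)]
    have cs: "permute_list (inv q) ds = cs"
      using permute_list_compose[OF qi, of q] q by (simp add: permutes_inv_o(1)[OF q(1)])
    have "bij_betw (\<lambda>p. p \<circ> q) (fib cs) (fib ds)"
    proof (rule bij_betwI[of _ _ _ "\<lambda>p. p \<circ> inv q"])
      show "(\<lambda>p. p \<circ> q) \<in> fib cs \<rightarrow> fib ds"
        using q by (auto simp: fib_def permute_list_compose intro: permutes_compose)
      show "(\<lambda>p. p \<circ> inv q) \<in> fib ds \<rightarrow> fib cs"
        using qi cs by (auto simp: fib_def permute_list_compose intro: permutes_compose)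
    qed (simp_all add: comp_assoc permutes_inv_o[OF q(1)])
    thus ?thesis by (simp add: bij_betw_same_card)
  qed
  let ?M = "permutations_of_multiset (mset cs)"
  have "card ?P = (\<Sum>ds\<in>?M. \<Sum>p\<in>{p \<in> ?P. permute_list p cs = ds}. 1)"
  proof -
    have "(\<lambda>p. permute_list p cs) ` ?P \<subseteq> ?M"
      by (auto simp: permutations_of_multiset_def)
    thus ?thesis by (simp only: sum.group[OF finite_permutations[OF finite_lessThan] finite_permutations_of_multiset] card_eq_sum)
  qed
  also have "\<dots> = (\<Sum>ds\<in>?M. card (fib cs))"
  proof (intro sum.cong refl)
    fix ds assume "ds \<in> ?M"
    hence "card (fib ds) = card (fib cs)" by (intro fib permutations_of_multisetD)
    thus "(\<Sum>p\<in>{p \<in> ?P. permute_list p cs = ds}. 1) = card (fib cs)" by (simp add: fib_def)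
  qed
  finally have "fact (length cs) = card ?M * card (fib cs)"
    by (simp add: card_permutations[of "{..<length cs}" "length cs"])
  moreover have "card ?M * (\<Prod>c\<in>set cs. fact (count_list cs c)) = fact (length cs)"
    using card_permutations_of_multiset_aux[of "mset cs"] by (simp add: count_mset)
  moreover have "fact (length cs) \<noteq> (0::nat)" by simp
  ultimately have "card (fib cs) = (\<Prod>c\<in>set cs. fact (count_list cs c))"
    by auto
  thus ?thesis using fib[OF assms] by (simp add: fib_def)
qed

text \<open>Each rearrangement of the columns arises from exactly \<open>mult_norm S\<close>
  permutations. This turns the sum over tables with a given monomial, which is a coefficient, into a
  sum over the group.\<close>

lemma sum_col_perm:
  fixes f :: "table \<Rightarrow> complex"
  assumes "S \<in> tables d m n" "d \<ge> 1"
  shows "(\<Sum>p | p permutes {..<m}. f (col_perm p S)) =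
    of_nat (mult_norm S) *
      (\<Sum>X | X \<in> tables d m n \<and> mset (List.transpose X) = mset (List.transpose S). f X)"
proof -
  let ?P = "{p. p permutes {..<m}}"
  let ?O = "{X. X \<in> tables d m n \<and> mset (List.transpose X) = mset (List.transpose S)}"
  have rS: "rect d m S" using assms by (simp add: tables_imp_rect)
  note len = length_transpose_rect[OF rS assms(2)]
  have fin: "finite ?O" using finite_tables[of d m n] by simp
  have fib: "{p \<in> ?P. col_perm p S = X} =
      {p. p permutes {..<length (List.transpose S)} \<and> permute_list p (List.transpose S) = List.transpose X}"
    if X: "X \<in> ?O" for X
  proof -
    have rX: "rect d m X" using X by (auto dest: tables_imp_rect)
    have "col_perm p S = X \<longleftrightarrow> permute_list p (List.transpose S) = List.transpose X"
      if p: "p permutes {..<m}" for p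
      using transpose_rect_inj[OF _ rX assms(2), of "col_perm p S"] transpose_col_perm[OF rS assms(2) p] rS
      by auto
    thus ?thesis by (auto simp: len)
  qed
  have "(\<Sum>p\<in>?P. f (col_perm p S)) = (\<Sum>X\<in>?O. \<Sum>p\<in>{p \<in> ?P. col_perm p S = X}. f (col_perm p S))"
  proof (subst sum.group[OF _ fin])
    show "(\<lambda>p. col_perm p S) ` ?P \<subseteq> ?O"
    proof (intro subsetI, elim imageE)
      fix X p assume p: "p \<in> ?P" "X = col_perm p S"
      have "set (permute_list p s) = set s" if "s \<in> set S" for s
        using that rS p by (intro set_permute_list) (auto simp: rect_def)
      hence "X \<in> tables d m n" using assms p rS by (auto simp: tables_def col_perm_def)
      moreover have "mset (List.transpose X) = mset (List.transpose S)"
        using p len by (simp add: transpose_col_perm[OF rS assms(2)])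
      ultimately show "X \<in> ?O" by simp
    qed
  qed (simp_all add: finite_permutations)
  also have "\<dots> = (\<Sum>X\<in>?O. of_nat (mult_norm S) * f X)"
  proof (intro sum.cong refl)
    fix X assume X: "X \<in> ?O"
    have "(\<Sum>p\<in>{p \<in> ?P. col_perm p S = X}. f (col_perm p S)) = of_nat (card {p \<in> ?P. col_perm p S = X}) * f X"
      by simp
    also have "card {p \<in> ?P. col_perm p S = X} = mult_norm S"
      unfolding fib[OF X] mult_norm_def using X by (intro card_permute_list_fiber) simp
    finally show "(\<Sum>p\<in>{p \<in> ?P. col_perm p S = X}. f (col_perm p S)) = of_nat (mult_norm S) * f X" .
  qed
  finally show ?thesis by (simp add: sum_distrib_left)
qed

lemma mult_norm_distinct: "distinct (List.transpose T) \<Longrightarrow> mult_norm T = 1"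
  by (auto simp: mult_norm_def distinct_count_atmost_1 count_mset intro!: prod.neutral)

section \<open>The sign of a pair of tables\<close>

text \<open>The form F of the opening comment; apart from the norm it is the coefficient with which
  \<open>X\<close> enters the defining sums of both vectors.\<close>

definition table_form :: "table \<Rightarrow> table \<Rightarrow> complex" where
  "table_form T X = table_sign T * table_sgn T X"

lemma table_form_eq: "table_form T X = (\<Prod>i<length T. row_form (T ! i) (X ! i))"
  by (simp add: table_form_def table_sign_def table_sgn_def row_form_def prod.distrib
      prod.list_conv_set_nth lessThan_atLeast0)

lemma table_form_col_perm:
  assumes "rect d m T" "rect d m X" "p permutes {..<m}"
  shows "table_form (col_perm p T) (col_perm p X) = of_int (sign p) ^ d * table_form T X"
proof -
  have "table_form (col_perm p T) (col_perm p X) = (\<Prod>i<d. of_int (sign p) * row_form (T ! i) (X ! i))"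
    unfolding table_form_eq
    using assms by (intro prod.cong) (auto simp: col_perm_def rect_def row_form_permute_list)
  thus ?thesis using assms by (simp add: table_form_eq prod.distrib rect_def)
qed

text \<open>Up to norms, \<open>e = 0\<close> gives the coefficients of \<open>Delta\<close> and
  \<open>e = 1\<close> those of \<open>Nabla\<close>. An exponent in place of two separate sums lets
  the \<open>d\<close> row signs be added to \<open>e\<close>, after which only parity
  matters.\<close>

definition perm_form :: "nat \<Rightarrow> nat \<Rightarrow> table \<Rightarrow> table \<Rightarrow> complex" where
  "perm_form m e T S = (\<Sum>p | p permutes {..<m}. of_int (sign p) ^ e * table_form T (col_perm p S))"

lemma perm_form_parity:
  assumes "even e \<longleftrightarrow> even e'"
  shows "perm_form m e T S = perm_form m e' T S"
proof -
  have "(of_int (sign p) :: complex) ^ e = of_int (sign p) ^ e'" for p :: "nat \<Rightarrow> nat"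
    using assms by (cases p rule: sign_cases) (auto simp: minus_one_power_iff)
  thus ?thesis by (simp add: perm_form_def)
qed

text \<open>Moving the column permutation to the other argument costs \<open>d\<close> signs, one for each row;
  this is why the parity of \<open>d\<close> decides between symmetric and exterior powers.\<close>

lemma perm_form_swap:
  assumes "rect d m T" "rect d m S"
    and sw: "\<And>p. p permutes {..<m} \<Longrightarrow> table_form T (col_perm p S) = \<epsilon> * table_form (col_perm p S) T"
  shows "perm_form m e T S = \<epsilon> * perm_form m (e + d) S T"
proof -
  have "perm_form m e T S = (\<Sum>p | p permutes {..<m}.
      \<epsilon> * (of_int (sign (inv p)) ^ (e + d) * table_form S (col_perm (inv p) T)))"
    unfolding perm_form_def
  proof (intro sum.cong refl)
    fix p assume "p \<in> {p. p permutes {..<m}}"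
    hence p: "p permutes {..<m}" by simp
    have s: "sign (inv p) = sign p"
      using p by (intro sign_inverse) (metis finite_lessThan permutation_permutes)
    have "col_perm p (col_perm (inv p) T) = T"
      using assms(1) p by (simp add: col_perm_compose permutes_inv_o)
    hence "table_form (col_perm p S) T = of_int (sign p) ^ d * table_form S (col_perm (inv p) T)"
      using table_form_col_perm[of d m S "col_perm (inv p) T" p] assms p by simp
    thus "of_int (sign p) ^ e * table_form T (col_perm p S) =
        \<epsilon> * (of_int (sign (inv p)) ^ (e + d) * table_form S (col_perm (inv p) T))"
      by (simp add: sw[OF p] s power_add)
  qed
  also have "\<dots> = \<epsilon> * perm_form m (e + d) S T"
    unfolding perm_form_def sum_distrib_left
    by (rule sum_permutations_inverse[of "\<lambda>p. \<epsilon> * (of_int (sign p) ^ (e + d) * table_form S (col_perm p T))", symmetric])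
  finally show ?thesis .
qed

section \<open>Coefficients of the vectors\<close>

definition monomial_key :: "'v list \<Rightarrow> 'v \<Rightarrow>\<^sub>0 nat" where
  "monomial_key cs = (\<Sum>c\<leftarrow>cs. Poly_Mapping.single c 1)"

lemma monomial_key_eq_iff: "monomial_key cs = monomial_key ds \<longleftrightarrow> mset cs = mset ds"
proof -
  have "Poly_Mapping.lookup (monomial_key cs) c = count (mset cs) c" for cs and c :: 'a
    unfolding monomial_key_def by (induction cs) (auto simp: lookup_add lookup_single when_def)
  thus ?thesis by (metis multiset_eqI poly_mapping_eqI)
qed

lemma sym_tab_eq_single: "sym_tab S = Poly_Mapping.single (monomial_key (List.transpose S)) 1"
  by (simp add: sym_tab_def sym_word_eq_single monomial_key_def)

lemma lookup_Delta:
  "Poly_Mapping.lookup (Delta d m n T) k =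
    (\<Sum>X | X \<in> tables d m n \<and> monomial_key (List.transpose X) = k. table_form T X) / of_nat (mult_norm T)"
proof -
  have "(\<Sum>X\<in>tables d m n. Poly_Mapping.lookup (smul (table_sgn T X) (sym_tab X)) k)
      = (\<Sum>X\<in>tables d m n. if monomial_key (List.transpose X) = k then table_sgn T X else 0)"
    by (intro sum.cong) (auto simp: sym_tab_eq_single lookup_single when_def)
  also have "\<dots> = (\<Sum>X | X \<in> tables d m n \<and> monomial_key (List.transpose X) = k. table_sgn T X)"
    by (simp add: sum.inter_filter[symmetric] finite_tables)
  finally show ?thesis
    by (simp add: Delta_def lookup_sum table_form_def sum_distrib_left sum_divide_distrib)
qed

lemma lookup_Nabla:
  "Poly_Mapping.lookup (Nabla d m n T) k =
    (\<Sum>X | X \<in> tables d m n \<and> distinct (List.transpose X) \<and> fset_of_list (List.transpose X) = k.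
       table_form T X * inv_sign (List.transpose X)) / of_nat (mult_norm T)"
proof -
  have "(\<Sum>X\<in>tables d m n. Poly_Mapping.lookup (smul (table_sgn T X) (ext_tab X)) k)
      = (\<Sum>X\<in>tables d m n. if distinct (List.transpose X) \<and> fset_of_list (List.transpose X) = k
           then table_sgn T X * inv_sign (List.transpose X) else 0)"
    by (intro sum.cong) (auto simp: ext_tab_def ext_word_eq_single lookup_single when_def)
  also have "\<dots> = (\<Sum>X | X \<in> tables d m n \<and> distinct (List.transpose X) \<and> fset_of_list (List.transpose X) = k.
      table_sgn T X * inv_sign (List.transpose X))"
    by (simp add: sum.inter_filter[symmetric] finite_tables)
  finally show ?thesis
    by (simp add: Nabla_def lookup_sum table_form_def sum_distrib_left sum_divide_distrib mult.assoc)
qed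

lemma mult_norm_pos: "mult_norm T > 0"
  by (auto simp: mult_norm_def intro!: prod_pos)

text \<open>The tables with the monomial of \<open>S\<close> are its column rearrangements, which
  the sum over permutations counts \<open>mult_norm S\<close> times each. The denominator is
  symmetric in \<open>T\<close> and \<open>S\<close>.\<close>

lemma pairing_Delta:
  assumes "S \<in> tables d m n" "d \<ge> 1"
  shows "pairing (Delta d m n T) (sym_tab S) =
    perm_form m 0 T S / (of_nat (mult_norm T) * of_nat (mult_norm S))"
  using sum_col_perm[OF assms, of "table_form T"] mult_norm_pos[of S]
  by (simp add: sym_tab_eq_single pairing_single lookup_Delta monomial_key_eq_iff perm_form_def field_simps)

lemma pairing_single_scaled:
  "pairing v (Poly_Mapping.single k a) = a * Poly_Mapping.lookup v k"
proof -
  have "pairing v (Poly_Mapping.single k a) = a * pairing v (Poly_Mapping.single k 1)"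
    unfolding pairing_def sum_distrib_left
    by (intro sum.cong) (auto simp: lookup_single when_def)
  thus ?thesis by (simp add: pairing_single)
qed

text \<open>The columns of \<open>S\<close> are distinct, so each rearrangement arises from one
  permutation \<open>p\<close>, and its sorting sign is \<open>sign p\<close> times that of
  \<open>S\<close>.\<close>

lemma pairing_Nabla:
  assumes "S \<in> tables d m n" "d \<ge> 1" "distinct (List.transpose S)"
  shows "pairing (Nabla d m n T) (ext_tab S) = perm_form m 1 T S / of_nat (mult_norm T)"
proof -
  let ?c = "List.transpose :: table \<Rightarrow> table"
  have rS: "rect d m S" using assms by (simp add: tables_imp_rect)
  \<comment> \<open>Among distinct lists the set of columns determines the multiset, so the
    coefficient runs over the same rearrangements as in the symmetric case.\<close>
  have iff: "distinct (?c X) \<and> fset_of_list (?c X) = fset_of_list (?c S) \<longleftrightarrow> mset (?c X) = mset (?c S)" for X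
  proof -
    have "fset_of_list (?c X) = fset_of_list (?c S) \<longleftrightarrow> set (?c X) = set (?c S)"
      by (metis fset_of_list.rep_eq fset_inject)
    thus ?thesis using assms(3)
      by (metis mset_eq_imp_distinct_iff set_eq_iff_mset_eq_distinct)
  qed
  have "(\<Sum>X | X \<in> tables d m n \<and> mset (?c X) = mset (?c S). table_form T X * inv_sign (?c X))
      = (\<Sum>p | p permutes {..<m}. table_form T (col_perm p S) * inv_sign (?c (col_perm p S)))"
    using sum_col_perm[OF assms(1,2), of "\<lambda>X. table_form T X * inv_sign (?c X)"] assms(3)
    by (simp add: mult_norm_distinct)
  also have "\<dots> = (\<Sum>p | p permutes {..<m}. of_int (sign p) * table_form T (col_perm p S) * inv_sign (?c S))"
    using assms rS
    by (intro sum.cong refl)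
       (simp add: transpose_col_perm[OF rS] inv_sign_permute_list length_transpose_rect[OF rS])
  finally have "(\<Sum>X | X \<in> tables d m n \<and> mset (?c X) = mset (?c S). table_form T X * inv_sign (?c X))
      = perm_form m 1 T S * inv_sign (?c S)"
    by (simp add: perm_form_def sum_distrib_right)
  \<comment> \<open>\<open>ext_tab S\<close> carries its own sorting sign, which cancels the one
    left in the sum.\<close>
  moreover have "inv_sign (?c S) * (perm_form m 1 T S * inv_sign (?c S)) = perm_form m 1 T S"
    using inv_sign_square[of "?c S"] by (simp add: mult_ac)
  ultimately show ?thesis using assms(3)
    by (simp add: ext_tab_def ext_word_eq_single pairing_single_scaled lookup_Nabla iff)
qed

section \<open>Expansion in the monomial bases\<close>

lemma expand_in_basis:
  assumes "finite I" "inj_on g I" "Poly_Mapping.keys v \<subseteq> g ` I"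
  shows "v = (\<Sum>i\<in>I. smul (pairing v (Poly_Mapping.single (g i) 1)) (Poly_Mapping.single (g i) 1))"
proof (rule poly_mapping_eqI)
  fix k
  have "Poly_Mapping.lookup (\<Sum>i\<in>I. smul (pairing v (Poly_Mapping.single (g i) 1)) (Poly_Mapping.single (g i) 1)) k
      = (\<Sum>i\<in>I. if g i = k then Poly_Mapping.lookup v (g i) else 0)"
    unfolding lookup_sum by (intro sum.cong) (auto simp: pairing_single lookup_single when_def)
  also have "\<dots> = (\<Sum>k'\<in>g ` I. if k' = k then Poly_Mapping.lookup v k' else 0)"
    by (simp add: sum.reindex[OF assms(2)])
  also have "\<dots> = Poly_Mapping.lookup v k"
    using assms by (auto simp: sum.delta in_keys_iff subset_iff)
  finally show "Poly_Mapping.lookup v k = Poly_Mapping.lookup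
      (\<Sum>i\<in>I. smul (pairing v (Poly_Mapping.single (g i) 1)) (Poly_Mapping.single (g i) 1)) k" by simp
qed

text \<open>The assumptions are symmetric in the two tuples, so by \<open>flip\<close> every result
  below is available in both directions. The bounds keep the letters of all words of both contents
  inside \<open>{1..n}\<close>.\<close>

locale dual_shapes =
  fixes d m n :: nat and \<alpha>s \<beta>s :: "nat list list"
  assumes d: "d \<ge> 1" and len: "length \<alpha>s = d" "length \<beta>s = d"
    and dual: "i < d \<Longrightarrow> dual_parts (\<alpha>s ! i) (\<beta>s ! i)"
    and size: "i < d \<Longrightarrow> sum_list (\<alpha>s ! i) = m" "i < d \<Longrightarrow> sum_list (\<beta>s ! i) = m"
    and bound: "i < d \<Longrightarrow> length (\<alpha>s ! i) \<le> n" "i < d \<Longrightarrow> length (\<beta>s ! i) \<le> n"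
begin

lemma flip: "dual_shapes d m n \<beta>s \<alpha>s"
  by unfold_locales (use d len dual size bound in \<open>auto intro: dual_parts_sym\<close>)

lemma A_tab_imp_tables:
  assumes "T \<in> A_tab \<alpha>s"
  shows "T \<in> tables d m n"
proof -
  have "length t = m \<and> set t \<subseteq> {1..n}" if t: "t \<in> set T" for t
  proof -
    obtain i where i: "i < d" "t = T ! i" using t assms
      by (auto simp: A_tab_def len(1) in_set_conv_nth)
    hence w: "t \<in> words (\<alpha>s ! i)" using assms by (simp add: A_tab_def len)
    hence "set t \<subseteq> {1..length (\<alpha>s ! i)}" by (rule words_entries)
    also have "\<dots> \<subseteq> {1..n}" using bound(1)[OF i(1)] by auto
    finally show ?thesis using w size(1)[OF i(1)] by (simp add: words_def)
  qed
  thus ?thesis using assms by (simp add: tables_def A_tab_def len)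
qed

lemma A_tab_imp_rect: "T \<in> A_tab \<alpha>s \<Longrightarrow> rect d m T"
  using A_tab_imp_tables tables_imp_rect by blast

lemma A_tab_col_perm:
  assumes "T \<in> A_tab \<alpha>s" "p permutes {..<m}"
  shows "col_perm p T \<in> A_tab \<alpha>s"
  using assms A_tab_imp_rect[OF assms(1)]
  by (auto simp: A_tab_def col_perm_def rect_def intro!: words_permute_list)

lemma table_form_support:
  assumes "T \<in> A_tab \<alpha>s" "X \<in> tables d m n" "table_form T X \<noteq> 0"
  shows "X \<in> A_tab \<beta>s"
proof -
  have r: "rect d m T" "rect d m X" using assms A_tab_imp_rect tables_imp_rect by blast+
  have "X ! i \<in> words (\<beta>s ! i)" if i: "i < d" for i
  proof (rule row_form_support[OF dual[OF i]])
    show "T ! i \<in> words (\<alpha>s ! i)" using assms i by (simp add: A_tab_def len)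
    show "length (T ! i) = length (X ! i)" using r i by (simp add: rect_def)
    show "row_form (T ! i) (X ! i) \<noteq> 0" using assms(3) i r by (simp add: table_form_eq rect_def)
  qed
  thus ?thesis using r by (simp add: A_tab_def len rect_def)
qed

lemma sort_columns:
  assumes "X \<in> A_tab \<alpha>s"
  obtains S where "S \<in> A_lex \<alpha>s" "mset (List.transpose S) = mset (List.transpose X)"
proof -
  note r = A_tab_imp_rect[OF assms]
  obtain p where p: "p permutes {..<length (List.transpose X)}"
      "permute_list p (List.transpose X) = sort (List.transpose X)"
    by (rule mset_eq_permutation[of "sort (List.transpose X)" "List.transpose X"]) simp
  hence pm: "p permutes {..<m}" by (simp add: length_transpose_rect[OF r d])
  have t: "List.transpose (col_perm p X) = sort (List.transpose X)"
    using p by (simp add: transpose_col_perm[OF r d pm])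
  show ?thesis
    by (rule that[of "col_perm p X"]) (use A_tab_col_perm[OF assms pm] in \<open>simp_all add: A_lex_def t\<close>)
qed

lemma A_lex_inj:
  assumes "S \<in> A_lex \<alpha>s" "T \<in> A_lex \<alpha>s" "mset (List.transpose S) = mset (List.transpose T)"
  shows "S = T"
proof (rule transpose_rect_inj[of d m])
  show "List.transpose S = List.transpose T"
    using assms by (metis (no_types, lifting) A_lex_def mem_Collect_eq properties_for_sort)
qed (use assms d A_tab_imp_rect in \<open>auto simp: A_lex_def\<close>)

text \<open>A nonzero coefficient needs a table with nonzero \<open>table_form\<close>, which has
  the dual content; sorting its columns produces the lexicographic table of the same
  monomial.\<close>

lemma Delta_expand:
  assumes "T \<in> A_tab \<alpha>s"
  shows "Delta d m n T = (\<Sum>S\<in>A_lex \<beta>s. smul (pairing (Delta d m n T) (sym_tab S)) (sym_tab S))"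
proof -
  interpret fl: dual_shapes d m n \<beta>s \<alpha>s by (rule flip)
  show ?thesis unfolding sym_tab_eq_single
  proof (rule expand_in_basis)
    show "finite (A_lex \<beta>s)" by (rule finite_subset[OF _ finite_A_tab]) (auto simp: A_lex_def)
    show "inj_on (\<lambda>S. monomial_key (List.transpose S)) (A_lex \<beta>s)"
      by (intro inj_onI fl.A_lex_inj) (simp_all add: monomial_key_eq_iff)
    show "Poly_Mapping.keys (Delta d m n T) \<subseteq> (\<lambda>S. monomial_key (List.transpose S)) ` A_lex \<beta>s"
    proof
      fix k assume "k \<in> Poly_Mapping.keys (Delta d m n T)"
      hence "(\<Sum>X | X \<in> tables d m n \<and> monomial_key (List.transpose X) = k. table_form T X) \<noteq> 0"
        by (auto simp: in_keys_iff lookup_Delta)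
      then obtain X where X: "X \<in> tables d m n" "monomial_key (List.transpose X) = k" "table_form T X \<noteq> 0"
        by (auto elim: sum.not_neutral_contains_not_neutral)
      hence "X \<in> A_tab \<beta>s" using assms table_form_support by blast
      then obtain S where S: "S \<in> A_lex \<beta>s" "mset (List.transpose S) = mset (List.transpose X)"
        by (rule fl.sort_columns)
      hence "k = monomial_key (List.transpose S)" using X(2) by (metis monomial_key_eq_iff)
      thus "k \<in> (\<lambda>S. monomial_key (List.transpose S)) ` A_lex \<beta>s" using S(1) by blast
    qed
  qed
qed

lemma Nabla_expand:
  assumes "T \<in> A_tab \<alpha>s"
  shows "Nabla d m n T = (\<Sum>S\<in>B_lex \<beta>s. smul (pairing (Nabla d m n T) (ext_tab S)) (ext_tab S))"
proof -
  interpret fl: dual_shapes d m n \<beta>s \<alpha>s by (rule flip)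
  let ?g = "\<lambda>S::table. fset_of_list (List.transpose S)"
  have fs: "fset_of_list cs = fset_of_list ds \<longleftrightarrow> set cs = set ds" for cs ds :: "nat list list"
    by (metis fset_of_list.rep_eq fset_inject)
  have "Nabla d m n T = (\<Sum>S\<in>B_lex \<beta>s. smul (pairing (Nabla d m n T) (Poly_Mapping.single (?g S) 1))
      (Poly_Mapping.single (?g S) 1))"
  proof (rule expand_in_basis)
    show "finite (B_lex \<beta>s)" by (rule finite_subset[OF _ finite_A_tab]) (auto simp: B_lex_def B_tab_def)
    show "inj_on ?g (B_lex \<beta>s)"
      by (intro inj_onI fl.A_lex_inj)
         (auto simp: A_lex_def B_lex_def B_tab_def fs set_eq_iff_mset_eq_distinct)
    show "Poly_Mapping.keys (Nabla d m n T) \<subseteq> ?g ` B_lex \<beta>s"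
    proof
      fix k assume "k \<in> Poly_Mapping.keys (Nabla d m n T)"
      hence "(\<Sum>X | X \<in> tables d m n \<and> distinct (List.transpose X) \<and> ?g X = k.
          table_form T X * inv_sign (List.transpose X)) \<noteq> 0"
        by (auto simp: in_keys_iff lookup_Nabla)
      then obtain X where X: "X \<in> tables d m n" "distinct (List.transpose X)" "?g X = k" "table_form T X \<noteq> 0"
        by (auto elim: sum.not_neutral_contains_not_neutral)
      hence "X \<in> A_tab \<beta>s" using assms table_form_support by blast
      then obtain S where S: "S \<in> A_lex \<beta>s" "mset (List.transpose S) = mset (List.transpose X)"
        by (rule fl.sort_columns)
      have "distinct (List.transpose S)" using S(2) X(2) mset_eq_imp_distinct_iff by blast
      hence "S \<in> B_lex \<beta>s" using S(1) by (simp add: A_lex_def B_lex_def B_tab_def)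
      moreover have "k = ?g S" using X(3) S(2) by (metis fs mset_eq_setD)
      ultimately show "k \<in> ?g ` B_lex \<beta>s" by blast
    qed
  qed
  \<comment> \<open>The columns of a table in \<open>B_lex\<close> are strictly increasing, so its
    wedge product is a basis vector with sign 1.\<close>
  also have "\<dots> = (\<Sum>S\<in>B_lex \<beta>s. smul (pairing (Nabla d m n T) (ext_tab S)) (ext_tab S))"
  proof (intro sum.cong refl)
    fix S assume "S \<in> B_lex \<beta>s"
    hence "ext_tab S = Poly_Mapping.single (?g S) 1"
      unfolding ext_tab_def
      by (intro ext_word_increasing) (simp add: B_lex_def B_tab_def strict_sorted_iff)
    thus "smul (pairing (Nabla d m n T) (Poly_Mapping.single (?g S) 1)) (Poly_Mapping.single (?g S) 1)
        = smul (pairing (Nabla d m n T) (ext_tab S)) (ext_tab S)" by simp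
  qed
  finally show ?thesis .
qed

text \<open>Column permutations preserve the content, so \<open>row_form_swap\<close> applies to
  each row of every summand; the row signs multiply to
  \<open>partitions_sign \<alpha>s\<close>.\<close>

lemma perm_form_dual:
  assumes "T \<in> A_tab \<alpha>s" "S \<in> A_tab \<beta>s"
  shows "perm_form m e T S = partitions_sign \<alpha>s * perm_form m (e + d) S T"
proof (rule perm_form_swap)
  interpret fl: dual_shapes d m n \<beta>s \<alpha>s by (rule flip)
  show rT: "rect d m T" using assms(1) by (rule A_tab_imp_rect)
  show "rect d m S" using assms(2) by (rule fl.A_tab_imp_rect)
  fix p assume "p permutes {..<m}"
  hence X: "col_perm p S \<in> A_tab \<beta>s" using assms(2) by (intro fl.A_tab_col_perm)
  note rX = fl.A_tab_imp_rect[OF X]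
  have "table_form T (col_perm p S) =
      (\<Prod>i<d. partition_sign (\<alpha>s ! i) * row_form (col_perm p S ! i) (T ! i))"
    unfolding table_form_eq
  proof (rule prod.cong)
    fix i assume "i \<in> {..<d}"
    hence i: "i < d" by simp
    show "row_form (T ! i) (col_perm p S ! i) = partition_sign (\<alpha>s ! i) * row_form (col_perm p S ! i) (T ! i)"
      by (rule row_form_swap[OF dual[OF i]])
         (use assms X i rT rX in \<open>simp_all add: A_tab_def len rect_def\<close>)
  qed (use rT in \<open>simp add: rect_def\<close>)
  also have "\<dots> = partitions_sign \<alpha>s * table_form (col_perm p S) T"
    using rX by (simp add: prod.distrib table_form_eq rect_def partitions_sign_def
        prod.list_conv_set_nth len lessThan_atLeast0)
  finally show "table_form T (col_perm p S) = partitions_sign \<alpha>s * table_form (col_perm p S) T" .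
qed

end

section \<open>Comparison of coefficients\<close>

lemma partitions_sign_square: "partitions_sign \<mu>s * partitions_sign \<mu>s = 1"
proof (induction \<mu>s)
  case (Cons \<mu> \<mu>s)
  have "partition_sign \<mu> * partition_sign \<mu> = 1"
    by (simp add: partition_sign_def word_sign_eq_inv_sign inv_sign_square)
  thus ?case using Cons by (simp add: partitions_sign_def mult_ac)
qed (simp add: partitions_sign_def)

lemma smul_scaled_sum: "smul c (\<Sum>i\<in>I. smul (f i) (v i)) = (\<Sum>i\<in>I. smul (c * f i) (v i))"
  by (rule poly_mapping_eqI) (simp add: lookup_sum sum_distrib_left mult.assoc)

theorem mainTheorem3:
  fixes d n m :: nat and lam :: "nat list list"
  assumes "d \<ge> 1" and "n \<ge> 1"
    and "length lam = d"
    and "\<forall>\<mu>\<in>set lam. partition_of m \<mu>"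
    and "\<forall>\<mu>\<in>set lam. length \<mu> \<le> n"
    and "\<forall>\<mu>\<in>set lam. part \<mu> 1 \<le> n"
  shows
    "(odd d \<longrightarrow>
       (\<forall>T\<in>B_tab (map conjugate lam).
          Delta d m n T = smul (partitions_sign lam)
            (\<Sum>S\<in>A_lex lam. smul (pairing (Nabla d m n S) (ext_tab T)) (sym_tab S))) \<and>
       (\<forall>S\<in>A_tab lam.
          Nabla d m n S = smul (partitions_sign lam)
            (\<Sum>T\<in>B_lex (map conjugate lam).
               smul (pairing (Delta d m n T) (sym_tab S)) (ext_tab T)))) \<and>
     (even d \<longrightarrow>
       (\<forall>S\<in>A_tab lam.
          Delta d m n S = smul (partitions_sign lam)
            (\<Sum>S'\<in>A_lex (map conjugate lam).
               smul (pairing (Delta d m n S') (sym_tab S)) (sym_tab S'))) \<and>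
       (\<forall>T\<in>B_tab lam.
          Nabla d m n T = smul (partitions_sign lam)
            (\<Sum>T'\<in>B_lex (map conjugate lam).
               smul (pairing (Nabla d m n T') (ext_tab T)) (ext_tab T'))))"
proof -
  let ?lam' = "map conjugate lam" and ?\<epsilon> = "partitions_sign lam"
  interpret L: dual_shapes d m n lam ?lam'
  proof
    fix i assume i: "i < d"
    hence mem: "lam ! i \<in> set lam" using assms(3) by simp
    hence p: "partition_of m (lam ! i)" using assms(4) by blast
    show D: "dual_parts (lam ! i) (?lam' ! i)" using dual_parts_conjugate[OF p] i assms(3) by simp
    show "sum_list (lam ! i) = m" using p by (simp add: partition_of_def)
    thus "sum_list (?lam' ! i) = m" using dual_parts_sum_list[OF D] by simp
    show "length (lam ! i) \<le> n" using mem assms(5) by blast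
    \<comment> \<open>The conjugate has as many parts as the largest part of the partition, so the
      bound on \<open>part \<mu> 1\<close> enters here.\<close>
    show "length (?lam' ! i) \<le> n" using mem assms(3,6) i by (simp add: length_conjugate)
  qed (use assms in simp_all)
  interpret L': dual_shapes d m n ?lam' lam by (rule L.flip)
  have lexA: "S \<in> A_tab \<mu>s" if "S \<in> A_lex \<mu>s" for S \<mu>s using that by (simp add: A_lex_def)
  have lexB: "T \<in> A_tab \<mu>s" "distinct (List.transpose T)" if "T \<in> B_lex \<mu>s" for T \<mu>s
    using that by (simp_all add: B_lex_def B_tab_def)
  have eps: "?\<epsilon> * perm_form m e S T = perm_form m (e + d) T S" if "S \<in> A_tab lam" "T \<in> A_tab ?lam'" for e S T
    using L.perm_form_dual[OF that, of e] partitions_sign_square[of lam] by (simp flip: mult.assoc)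
  \<comment> \<open>For odd \<open>d\<close> the exponent \<open>1 + d\<close> is even, which turns
    a coefficient of \<open>Nabla\<close> into one of \<open>Delta\<close>. The norm of
    \<open>T\<close> is 1 and that of \<open>S\<close> divides both sides.\<close>
  have DN: "pairing (Delta d m n T) (sym_tab S) = ?\<epsilon> * pairing (Nabla d m n S) (ext_tab T)"
    if "odd d" "S \<in> A_tab lam" "T \<in> A_tab ?lam'" "distinct (List.transpose T)" for S T
    using that eps[OF that(2,3), of 1] perm_form_parity[of "1 + d" 0 m T S]
      L.A_tab_imp_tables[OF that(2)] L'.A_tab_imp_tables[OF that(3)] L.d
    by (simp add: pairing_Delta pairing_Nabla mult_norm_distinct)
  \<comment> \<open>For even \<open>d\<close> the exponent keeps its parity, and both sides have the
    product of the two norms as denominator.\<close>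
  have DD: "pairing (Delta d m n S) (sym_tab T) = ?\<epsilon> * pairing (Delta d m n T) (sym_tab S)"
    if "even d" "S \<in> A_tab lam" "T \<in> A_tab ?lam'" for S T
    using that L.perm_form_dual[OF that(2,3), of 0] perm_form_parity[of d 0 m T S]
      L.A_tab_imp_tables[OF that(2)] L'.A_tab_imp_tables[OF that(3)] L.d
    by (simp add: pairing_Delta mult_ac)
  \<comment> \<open>Distinct columns in both tables make both norms 1.\<close>
  have NN: "pairing (Nabla d m n S) (ext_tab T) = ?\<epsilon> * pairing (Nabla d m n T) (ext_tab S)"
    if "even d" "S \<in> A_tab lam" "distinct (List.transpose S)" "T \<in> A_tab ?lam'" "distinct (List.transpose T)" for S T
    using that L.perm_form_dual[OF that(2,4), of 1] perm_form_parity[of "1 + d" 1 m T S]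
      L.A_tab_imp_tables[OF that(2)] L'.A_tab_imp_tables[OF that(4)] L.d
    by (simp add: pairing_Nabla mult_norm_distinct)
  have ND: "pairing (Nabla d m n S) (ext_tab T) = ?\<epsilon> * pairing (Delta d m n T) (sym_tab S)"
    if "odd d" "S \<in> A_tab lam" "T \<in> A_tab ?lam'" "distinct (List.transpose T)" for S T
    using DN[OF that] partitions_sign_square[of lam] by (simp flip: mult.assoc)
  \<comment> \<open>Once the sign is moved into the sums, the right-hand sides match
    \<open>Delta_expand\<close> and \<open>Nabla_expand\<close> term by term, and the pairing
    identities above settle each case.\<close>
  show ?thesis unfolding smul_scaled_sum
  proof (intro conjI impI ballI)
    fix T assume "odd d" "T \<in> B_tab ?lam'"
    thus "Delta d m n T = (\<Sum>S\<in>A_lex lam. smul (?\<epsilon> * pairing (Nabla d m n S) (ext_tab T)) (sym_tab S))"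
      by (subst L'.Delta_expand) (auto simp: B_tab_def DN lexA intro!: sum.cong)
  next
    fix S assume "odd d" "S \<in> A_tab lam"
    thus "Nabla d m n S = (\<Sum>T\<in>B_lex ?lam'. smul (?\<epsilon> * pairing (Delta d m n T) (sym_tab S)) (ext_tab T))"
      by (subst L.Nabla_expand) (auto simp: ND lexB intro!: sum.cong)
  next
    fix S assume "even d" "S \<in> A_tab lam"
    thus "Delta d m n S = (\<Sum>S'\<in>A_lex ?lam'. smul (?\<epsilon> * pairing (Delta d m n S') (sym_tab S)) (sym_tab S'))"
      by (subst L.Delta_expand) (auto simp: DD lexA intro!: sum.cong)
  next
    fix T assume "even d" "T \<in> B_tab lam"
    thus "Nabla d m n T = (\<Sum>T'\<in>B_lex ?lam'. smul (?\<epsilon> * pairing (Nabla d m n T') (ext_tab T)) (ext_tab T'))"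
      by (subst L.Nabla_expand) (auto simp: B_tab_def NN lexB intro!: sum.cong)
  qed
qed

end
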